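(* Let $p$ be a prime, $n\ge 1$ an integer and $\alpha$ a real number with $\alpha>2n-1$. Then the integral $\int_{\mathrm{Mat}(n,\mathbb{Q}_p)}\gamma(z)^{-\alpha}\,d\mathrm{vol}(z)$ converges and $$\int_{\mathrm{Mat}(n,\mathbb{Q}_p)} \gamma(z)^{-\alpha}\,d\mathrm{vol}(z)=\prod_{j=1}^n\frac{1-p^{-\alpha+n-j}}{1-p^{-\alpha+n+j-1}}.$$
   Context: $\mathbb{Q}_p$ is the field of $p$-adic numbers, $\mathbb{O}_p$ the ring of $p$-adic integers. $\mathrm{Mat}(n,\mathbb{Q}_p)$ is the space of $n\times n$ matrices over $\mathbb{Q}_p$, and $\mathrm{vol}$ is the translation-invariant ($\sigma$-finite, Haar) measure on it normalized by $\mathrm{vol}(\mathrm{Mat}(n,\mathbb{O}_p))=1$. $\mathrm{GL}(n,\mathbb{O}_p)$ is the group of matrices over $\mathbb{O}_p$ invertible over $\mathbb{O}_p$. Any $z\in\mathrm{Mat}(n,\mathbb{Q}_p)$ can be written as $z=A\,\mathrm{diag}(p^{-k_1},\dots,p^{-k_n})\,B$ with $A,B\in\mathrm{GL}(n,\mathbb{O}_p)$ and $k_1\ge k_2\ge\dots\ge k_n\ge-\infty$ ($k_j$ integers or $-\infty$, with the convention that the entry $p^{-k_j}$ is $0$ if $k_j=-\infty$); the $k_j$ are determined by $z$. Define $\gamma(z)=\prod_{j:\,k_j>0}p^{k_j}$ (a positive real number; the empty product equals $1$). *)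

theory Defs
  imports
    "HOL-Analysis.Analysis"
    "HOL-Computational_Algebra.Fraction_Field"
    "HOL-Library.Extended"
    "Berlekamp_Zassenhaus.Finite_Field"
begin

no_notation Pinf (\<open>\<infinity>\<close>)
no_notation Minf (\<open>-\<infinity>\<close>)

text \<open>
  The prime \<open>p\<close> is the cardinality of a type \<open>'p\<close> of class \<^class>\<open>prime_card\<close>, so that the
  \<open>p\<close>-adic numbers form a type. A \<open>p\<close>-adic integer is a compatible system of residues: its
  component with index \<open>k\<close> is the representative in \<open>{0..<p^k}\<close> of its class modulo \<open>p^k\<close>.
\<close>

lemma card_prime_gt_1: "int CARD('p::prime_card) > 1"
  using prime_card_int[where 'a='p] prime_gt_1_int by blast

lemma card_pow_pos [simp]: "int CARD('p::prime_card) ^ k > 0"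
  using card_prime_gt_1[where 'p='p] by simp

lemma mod_pow_mod: "m \<le> n \<Longrightarrow> (x::int) mod q ^ n mod q ^ m = x mod q ^ m"
  by (simp add: le_imp_power_dvd mod_mod_cancel)

typedef ('p::prime_card) padic_int =
  "{x :: nat \<Rightarrow> int. \<forall>k. x k \<in> {0..<int CARD('p) ^ k} \<and> x (Suc k) mod int CARD('p) ^ k = x k}"
  morphisms padic_residue Abs_padic_int
  by (rule exI[of _ "\<lambda>_. 0"]) simp

setup_lifting type_definition_padic_int

lemma residue_range: "0 \<le> padic_residue (x::'p::prime_card padic_int) k" "padic_residue x k < int CARD('p) ^ k"
  using padic_residue[of x] by auto

lemma residue_mod_self [simp]:
  "padic_residue (x::'p::prime_card padic_int) k mod int CARD('p) ^ k = padic_residue x k"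
  using residue_range[of x k] by simp

lemma residue_mod:
  "m \<le> n \<Longrightarrow> padic_residue (x::'p::prime_card padic_int) n mod int CARD('p) ^ m = padic_residue x m"
proof (induction n)
  case (Suc n)
  show ?case
  proof (cases "m = Suc n")
    case False
    with Suc have "m \<le> n" by simp
    have "padic_residue x (Suc n) mod int CARD('p) ^ m
        = padic_residue x (Suc n) mod int CARD('p) ^ n mod int CARD('p) ^ m"
      by (simp add: mod_pow_mod \<open>m \<le> n\<close>)
    also have "padic_residue x (Suc n) mod int CARD('p) ^ n = padic_residue x n"
      using padic_residue[of x] by auto
    finally show ?thesis using Suc.IH \<open>m \<le> n\<close> by simp
  qed (simp del: power_Suc)
qed (use residue_range[of x 0] in simp)

lemma padic_int_eqI: "(\<And>k. padic_residue x k = padic_residue y k) \<Longrightarrow> x = y"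
  by (metis padic_residue_inject ext)

text \<open>Every compatible system of residues, reduced or not, defines a \<open>p\<close>-adic integer.\<close>

definition padic_of_residues :: "(nat \<Rightarrow> int) \<Rightarrow> 'p::prime_card padic_int" where
  "padic_of_residues f = Abs_padic_int (\<lambda>k. f k mod int CARD('p) ^ k)"

lemma residue_padic_of_residues:
  assumes "\<And>k. f (Suc k) mod int CARD('p) ^ k = f k mod int CARD('p) ^ k"
  shows "padic_residue (padic_of_residues f :: 'p::prime_card padic_int) k = f k mod int CARD('p) ^ k"
  unfolding padic_of_residues_def
  by (subst Abs_padic_int_inverse) (use assms in \<open>auto simp: mod_pow_mod simp del: power_Suc\<close>)

instantiation padic_int :: (prime_card) comm_ring_1
begin

definition "0 = (padic_of_residues (\<lambda>_. 0) :: 'a padic_int)"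
definition "1 = (padic_of_residues (\<lambda>_. 1) :: 'a padic_int)"
definition "x + y = (padic_of_residues (\<lambda>k. padic_residue x k + padic_residue y k) :: 'a padic_int)"
definition "x * y = (padic_of_residues (\<lambda>k. padic_residue x k * padic_residue y k) :: 'a padic_int)"
definition "- x = (padic_of_residues (\<lambda>k. - padic_residue x k) :: 'a padic_int)"
definition "x - y = (padic_of_residues (\<lambda>k. padic_residue x k - padic_residue y k) :: 'a padic_int)"

lemma residue_Suc_mod:
  "padic_residue (x::'a padic_int) (Suc k) mod int CARD('a) ^ k = padic_residue x k mod int CARD('a) ^ k"
  by (simp add: residue_mod)

lemma residue_simps:
  "padic_residue (0 :: 'a padic_int) k = 0"
  "padic_residue (1 :: 'a padic_int) k = 1 mod int CARD('a) ^ k"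
  "padic_residue (x + y :: 'a padic_int) k = (padic_residue x k + padic_residue y k) mod int CARD('a) ^ k"
  "padic_residue (x * y :: 'a padic_int) k = (padic_residue x k * padic_residue y k) mod int CARD('a) ^ k"
  "padic_residue (- x :: 'a padic_int) k = (- padic_residue x k) mod int CARD('a) ^ k"
  "padic_residue (x - y :: 'a padic_int) k = (padic_residue x k - padic_residue y k) mod int CARD('a) ^ k"
  unfolding zero_padic_int_def one_padic_int_def plus_padic_int_def times_padic_int_def
    uminus_padic_int_def minus_padic_int_def
  by (subst residue_padic_of_residues;
      simp add: mod_add_cong[OF residue_Suc_mod residue_Suc_mod]
        mod_mult_cong[OF residue_Suc_mod residue_Suc_mod] mod_minus_cong[OF residue_Suc_mod]
        mod_diff_cong[OF residue_Suc_mod residue_Suc_mod])+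

instance
proof
  fix a b c :: "'a padic_int"
  show "a + b + c = a + (b + c)"
    by (rule padic_int_eqI) (simp add: residue_simps mod_simps add.assoc)
  show "a + b = b + a"
    by (rule padic_int_eqI) (simp add: residue_simps add.commute)
  show "0 + a = a"
    by (rule padic_int_eqI) (simp add: residue_simps)
  show "- a + a = 0"
    by (rule padic_int_eqI) (simp add: residue_simps mod_simps)
  show "a - b = a + - b"
    by (rule padic_int_eqI) (simp add: residue_simps mod_simps)
  show "a * b * c = a * (b * c)"
    by (rule padic_int_eqI) (simp add: residue_simps mod_simps mult.assoc)
  show "a * b = b * a"
    by (rule padic_int_eqI) (simp add: residue_simps mult.commute)
  show "1 * a = a"
    by (rule padic_int_eqI) (simp add: residue_simps mod_simps)
  show "(a + b) * c = a * c + b * c"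
    by (rule padic_int_eqI) (simp add: residue_simps mod_simps distrib_right)
  have "padic_residue (0::'a padic_int) 1 \<noteq> padic_residue (1::'a padic_int) 1"
    using card_prime_gt_1[where 'p='a] by (simp add: residue_simps)
  then show "(0::'a padic_int) \<noteq> 1" by metis
qed

end

lemma residue_of_nat: "padic_residue (of_nat n :: 'p::prime_card padic_int) k = int n mod int CARD('p) ^ k"
  by (induction n) (simp_all add: residue_simps mod_simps)

text \<open>Elements with nonzero padic_residue modulo \<open>p\<close> are units; every nonzero element is
  a power of \<open>p\<close> times a unit.\<close>

lemma padic_int_inverse:
  assumes "padic_residue (x::'p::prime_card padic_int) 1 \<noteq> 0"
  shows "\<exists>y. x * y = 1"
proof -
  let ?p = "int CARD('p)"
  have cop: "coprime (padic_residue x k) (?p ^ k)" for k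
  proof (cases "k = 0")
    case False
    then have "padic_residue x k mod ?p = padic_residue x 1"
      using residue_mod[of 1 k x] by simp
    with assms have "\<not> ?p dvd padic_residue x k" by (metis mod_0_imp_dvd dvd_imp_mod_0)
    then have "coprime ?p (padic_residue x k)"
      using prime_card_int[where 'a='p] prime_imp_coprime by blast
    then show ?thesis by (simp add: coprime_commute)
  qed simp
  have "\<exists>z. [padic_residue x k * z = 1] (mod ?p ^ k)" for k
    using cop cong_solve_coprime_int by blast
  then obtain z where z: "\<And>k. [padic_residue x k * z k = 1] (mod ?p ^ k)" by metis
  have "z (Suc k) mod ?p ^ k = z k mod ?p ^ k" for k
  proof -
    have "[padic_residue x (Suc k) * z (Suc k) = 1] (mod ?p ^ k)"
      using z[of "Suc k"] by (rule cong_dvd_modulus) simp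
    moreover have "[padic_residue x (Suc k) = padic_residue x k] (mod ?p ^ k)"
      by (simp add: cong_def residue_mod)
    ultimately have "[padic_residue x k * z (Suc k) = 1] (mod ?p ^ k)"
      by (meson cong_scalar_right cong_sym cong_trans)
    then have "[padic_residue x k * z (Suc k) = padic_residue x k * z k] (mod ?p ^ k)"
      using z[of k] cong_sym cong_trans by blast
    then show ?thesis
      using cop by (simp add: cong_mult_lcancel cong_def[symmetric])
  qed
  then have "padic_residue (padic_of_residues z :: 'p padic_int) k = z k mod ?p ^ k" for k
    by (rule residue_padic_of_residues)
  then have "x * padic_of_residues z = 1"
    using z by (intro padic_int_eqI) (simp add: residue_simps mod_simps cong_def)
  then show ?thesis ..
qed

lemma padic_int_dvd_iff:
  "of_nat CARD('p) ^ m dvd (x::'p::prime_card padic_int) \<longleftrightarrow> padic_residue x m = 0"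
proof
  let ?p = "int CARD('p)"
  have pm: "padic_residue (of_nat CARD('p) ^ m :: 'p padic_int) k = ?p ^ m mod ?p ^ k" for k
    using residue_of_nat[of "CARD('p) ^ m" k, where 'p='p] by simp
  show "padic_residue x m = 0" if dvd: "of_nat CARD('p) ^ m dvd x"
    using dvd pm by (auto simp: dvd_def residue_simps mod_simps)
  assume 0: "padic_residue x m = 0"
  have div: "?p ^ m dvd padic_residue x (k + m)" for k
    using residue_mod[of m "k + m" x] 0 by auto
  define f where "f k = padic_residue x (k + m) div ?p ^ m" for k
  have f: "?p ^ m * f k = padic_residue x (k + m)" for k
    using div by (simp add: f_def)
  have "f (Suc k) mod ?p ^ k = f k mod ?p ^ k" for k
  proof -
    have "[?p ^ m * f (Suc k) = ?p ^ m * f k] (mod ?p ^ m * ?p ^ k)"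
      unfolding f by (simp add: cong_def residue_mod residue_range flip: power_add add.commute[of k m])
    then show ?thesis
      by (simp add: cong_def mod_mult_mult1)
  qed
  then have r: "padic_residue (padic_of_residues f :: 'p padic_int) k = f k mod ?p ^ k" for k
    by (rule residue_padic_of_residues)
  have "of_nat CARD('p) ^ m * padic_of_residues f = x"
  proof (rule padic_int_eqI)
    fix k
    show "padic_residue (of_nat CARD('p) ^ m * padic_of_residues f :: 'p padic_int) k = padic_residue x k"
      by (simp add: residue_simps pm r mod_simps f residue_mod)
  qed
  then show "of_nat CARD('p) ^ m dvd x" by (metis dvd_triv_left)
qed

lemma padic_int_factor:
  assumes "(x::'p::prime_card padic_int) \<noteq> 0"
  obtains m u where "x = of_nat CARD('p) ^ m * u" "u dvd 1" "padic_residue x m = 0" "padic_residue x (Suc m) \<noteq> 0"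
proof -
  have "\<exists>k. padic_residue x k \<noteq> 0"
    using assms padic_int_eqI[of x 0] by (auto simp: residue_simps)
  moreover have r0: "padic_residue x 0 = 0" using residue_range[of x 0] by simp
  ultimately obtain m where m: "padic_residue x m = 0" "padic_residue x (Suc m) \<noteq> 0"
    using nat_induct[of "\<lambda>k. padic_residue x k = 0"] by blast
  then obtain u where u: "x = of_nat CARD('p) ^ m * u"
    by (auto simp: dvd_def dest: padic_int_dvd_iff[THEN iffD2])
  have "padic_residue u 1 \<noteq> 0"
  proof
    assume "padic_residue u 1 = 0"
    then have "of_nat CARD('p) ^ 1 dvd u" by (simp only: padic_int_dvd_iff)
    then have "of_nat CARD('p) ^ Suc m dvd x" unfolding u
      using mult_dvd_mono[of "of_nat CARD('p)" u "of_nat CARD('p) ^ m" "of_nat CARD('p) ^ m"]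
      by (simp add: mult.commute)
    with m show False by (simp only: padic_int_dvd_iff)
  qed
  then have "u dvd 1" using padic_int_inverse by (metis dvdI)
  with u m that show ?thesis by blast
qed

instance padic_int :: (prime_card) idom
proof
  fix x y :: "'a padic_int"
  let ?P = "of_nat CARD('a) :: 'a padic_int"
  assume "x \<noteq> 0" "y \<noteq> 0"
  obtain m u where u: "x = ?P ^ m * u" "u dvd 1"
    by (rule padic_int_factor[OF \<open>x \<noteq> 0\<close>]) (rule that)
  obtain n v where v: "y = ?P ^ n * v" "v dvd 1"
    by (rule padic_int_factor[OF \<open>y \<noteq> 0\<close>]) (rule that)
  have "x * y \<noteq> 0"
  proof
    assume "x * y = 0"
    obtain u' where u': "u * u' = 1" using u(2) by (metis dvdE)
    obtain v' where v': "v * v' = 1" using v(2) by (metis dvdE)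
    have "?P ^ (m + n) = ?P ^ m * ?P ^ n * (u * u') * (v * v')"
      by (simp add: power_add u' v')
    also have "\<dots> = (x * y) * (u' * v')"
      unfolding u v by (simp only: ac_simps)
    finally have "?P ^ (m + n) = 0" using \<open>x * y = 0\<close> by simp
    then have "padic_residue (of_nat (CARD('a) ^ (m + n)) :: 'a padic_int) (Suc (m + n)) = 0"
      by (simp add: residue_simps)
    then have "int CARD('a) ^ (m + n) mod int CARD('a) ^ Suc (m + n) = 0"
      using residue_of_nat[of "CARD('a) ^ (m + n)" "Suc (m + n)", where 'p='a] by (simp del: power_Suc)
    then show False
      using card_prime_gt_1[where 'p='a] by simp
  qed
  then show "x * y \<noteq> 0" .
qed

text \<open>
  The field of \<open>p\<close>-adic numbers is the field of fractions of the ring of \<open>p\<close>-adic integers.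
  It is a type of its own in order to carry the \<open>p\<close>-adic metric.
\<close>

typedef ('p::prime_card) padic = "UNIV :: 'p padic_int fract set"
  by simp

setup_lifting type_definition_padic

instantiation padic :: (prime_card) field
begin

lift_definition zero_padic :: "'a padic" is 0 .
lift_definition one_padic :: "'a padic" is 1 .
lift_definition plus_padic :: "'a padic \<Rightarrow> 'a padic \<Rightarrow> 'a padic" is "(+)" .
lift_definition minus_padic :: "'a padic \<Rightarrow> 'a padic \<Rightarrow> 'a padic" is "(-)" .
lift_definition uminus_padic :: "'a padic \<Rightarrow> 'a padic" is uminus .
lift_definition times_padic :: "'a padic \<Rightarrow> 'a padic \<Rightarrow> 'a padic" is "(*)" .
lift_definition inverse_padic :: "'a padic \<Rightarrow> 'a padic" is inverse .
lift_definition divide_padic :: "'a padic \<Rightarrow> 'a padic \<Rightarrow> 'a padic" is "(div)" .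

instance
  by standard (transfer; simp add: field_simps)+

end

definition of_padic_int :: "'p::prime_card padic_int \<Rightarrow> 'p padic" where
  "of_padic_int x = Abs_padic (Fract x 1)"

lemma Rep_of_padic_int: "Rep_padic (of_padic_int x) = Fract x 1"
  by (simp add: of_padic_int_def Abs_padic_inverse)

definition padic_integers :: "'p::prime_card padic set" where
  "padic_integers = range of_padic_int"

definition padic_p :: "'p::prime_card padic" where
  "padic_p = of_nat CARD('p)"

definition padic_val :: "'p::prime_card padic \<Rightarrow> int" where
  "padic_val x = (GREATEST k. x * padic_p powi (- k) \<in> padic_integers)"

definition padic_abs :: "'p::prime_card padic \<Rightarrow> real" where
  "padic_abs x = (if x = 0 then 0 else real CARD('p) powi (- padic_val x))"

lemma of_padic_int_simps [simp]:
  "of_padic_int 0 = 0" "of_padic_int 1 = 1"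
  "of_padic_int (x + y) = of_padic_int x + of_padic_int y"
  "of_padic_int (x - y) = of_padic_int x - of_padic_int y"
  "of_padic_int (- x) = - of_padic_int x"
  "of_padic_int (x * y) = of_padic_int x * of_padic_int y"
  by (simp_all add: Rep_of_padic_int Zero_fract_def One_fract_def zero_padic.rep_eq one_padic.rep_eq
    plus_padic.rep_eq minus_padic.rep_eq uminus_padic.rep_eq times_padic.rep_eq
    flip: Rep_padic_inject)

lemma of_padic_int_eq_iff [simp]: "of_padic_int x = of_padic_int y \<longleftrightarrow> x = y"
  by (simp add: Rep_of_padic_int eq_fract flip: Rep_padic_inject)

lemma of_padic_int_of_nat [simp]: "of_padic_int (of_nat n) = of_nat n"
  by (induction n) simp_all

lemma of_padic_int_power [simp]: "of_padic_int (x ^ n) = of_padic_int x ^ n"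
  by (induction n) simp_all

lemma padic_integers_closed:
  "0 \<in> padic_integers" "1 \<in> padic_integers" "padic_p \<in> padic_integers"
  "x \<in> padic_integers \<Longrightarrow> y \<in> padic_integers \<Longrightarrow> x + y \<in> padic_integers"
  "x \<in> padic_integers \<Longrightarrow> y \<in> padic_integers \<Longrightarrow> x - y \<in> padic_integers"
  "x \<in> padic_integers \<Longrightarrow> - x \<in> padic_integers"
  "x \<in> padic_integers \<Longrightarrow> y \<in> padic_integers \<Longrightarrow> x * y \<in> padic_integers"
  unfolding padic_integers_def padic_p_def
  by (auto simp flip: of_padic_int_simps of_padic_int_of_nat)

lemma padic_integers_power: "x \<in> padic_integers \<Longrightarrow> x ^ n \<in> padic_integers"
  by (induction n) (auto intro: padic_integers_closed)

lemma padic_p_not_zero [simp]: "padic_p \<noteq> (0 :: 'p::prime_card padic)"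
proof
  assume "padic_p = (0 :: 'p padic)"
  then have "of_padic_int (of_nat CARD('p)) = (of_padic_int 0 :: 'p padic)"
    by (simp add: padic_p_def)
  then have "(of_nat CARD('p) :: 'p padic_int) = 0" by (simp only: of_padic_int_eq_iff)
  then have "padic_residue (of_nat CARD('p) :: 'p padic_int) 2 = 0" by (simp add: residue_simps)
  then have "int CARD('p) mod (int CARD('p))\<^sup>2 = 0" by (simp only: residue_of_nat)
  then show False using card_prime_gt_1[where 'p='p] by (simp add: power2_eq_square)
qed

lemma padic_p_inverse_not_integer: "inverse padic_p \<notin> (padic_integers :: 'p::prime_card padic set)"
proof
  assume "inverse padic_p \<in> (padic_integers :: 'p padic set)"
  then obtain y :: "'p padic_int" where "inverse padic_p = of_padic_int y"
    by (auto simp: padic_integers_def)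
  then have "padic_p * of_padic_int y = 1" by (metis padic_p_not_zero right_inverse)
  then have "of_padic_int (of_nat CARD('p) * y) = of_padic_int 1" by (simp add: padic_p_def)
  then have "of_nat CARD('p) ^ 1 dvd (1 :: 'p padic_int)"
    by (metis of_padic_int_eq_iff dvd_triv_left power_one_right)
  then have "padic_residue (1 :: 'p padic_int) 1 = 0" by (simp only: padic_int_dvd_iff)
  then show False using card_prime_gt_1[where 'p='p] by (simp add: residue_simps)
qed

lemma padic_factor:
  assumes "(x :: 'p::prime_card padic) \<noteq> 0"
  obtains k u where "x = padic_p powi k * u" "u \<in> padic_integers" "inverse u \<in> padic_integers"
proof -
  have "\<exists>a b. b \<noteq> 0 \<and> x = of_padic_int a / of_padic_int b"
  proof (cases "Rep_padic x")
    case (Fract a b)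
    then have "x = of_padic_int a / of_padic_int b"
      by (simp add: Rep_of_padic_int divide_padic.rep_eq flip: Rep_padic_inject)
    with Fract show ?thesis by blast
  qed
  then obtain a b where ab: "b \<noteq> 0" "x = of_padic_int a / of_padic_int b" by blast
  with assms have "a \<noteq> 0" by auto
  have int: "\<exists>m u. of_padic_int c = padic_p ^ m * u \<and> u \<in> padic_integers \<and> inverse u \<in> padic_integers"
    if c: "c \<noteq> 0" for c :: "'p padic_int"
  proof -
    obtain m u v where u: "c = of_nat CARD('p) ^ m * u" "u * v = 1"
      using padic_int_factor[OF c] unfolding dvd_def by metis
    have "of_padic_int u * of_padic_int v = 1" using u(2) by (metis of_padic_int_simps(2,6))
    then have "inverse (of_padic_int u) = of_padic_int v" by (rule inverse_unique)
    then show ?thesis using u(1)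
      by (intro exI[of _ m] exI[of _ "of_padic_int u"]) (simp add: padic_p_def padic_integers_def)
  qed
  obtain m u where u: "of_padic_int a = padic_p ^ m * u" "u \<in> padic_integers" "inverse u \<in> padic_integers"
    using int[OF \<open>a \<noteq> 0\<close>] by blast
  obtain n v where v: "of_padic_int b = padic_p ^ n * v" "v \<in> padic_integers" "inverse v \<in> padic_integers"
    using int[OF \<open>b \<noteq> 0\<close>] by blast
  have "x = padic_p powi (int m - int n) * (u * inverse v)"
    by (simp add: ab u(1) v(1) power_int_diff field_simps)
  moreover have "u * inverse v \<in> padic_integers" "inverse (u * inverse v) \<in> padic_integers"
    using u v by (auto intro: padic_integers_closed)
  ultimately show ?thesis using that by blast
qed

lemma padic_val_iff:
  assumes "(x :: 'p::prime_card padic) \<noteq> 0"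
  shows "x * padic_p powi (- k) \<in> padic_integers \<longleftrightarrow> k \<le> padic_val x"
proof -
  obtain v u where u: "x = padic_p powi v * u" "u \<in> padic_integers" "inverse u \<in> padic_integers"
    using padic_factor[OF assms] .
  have *: "x * padic_p powi (- k) \<in> padic_integers \<longleftrightarrow> k \<le> v" for k
  proof
    have eq: "x * padic_p powi (- k) = padic_p powi (v - k) * u"
      by (simp add: u(1) power_int_diff power_int_minus field_simps)
    show "x * padic_p powi (- k) \<in> padic_integers" if "k \<le> v"
      unfolding eq using that u(2)
      by (auto simp: power_int_def intro!: padic_integers_closed padic_integers_power)
    show "k \<le> v" if "x * padic_p powi (- k) \<in> padic_integers"
    proof (rule ccontr)
      assume "\<not> k \<le> v"
      then have kv: "v - k + int (nat (k - v - 1)) = - 1" by simp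
      have "u \<noteq> 0" using u(1) assms by auto
      then have "padic_p powi (v - k) = x * padic_p powi (- k) * inverse u" by (simp add: eq)
      also have "\<dots> \<in> padic_integers" using that u(3) by (rule padic_integers_closed)
      finally have "padic_p powi (v - k) * padic_p ^ nat (k - v - 1) \<in> (padic_integers :: 'p padic set)"
        by (intro padic_integers_closed padic_integers_power)
      also have "padic_p powi (v - k) * padic_p ^ nat (k - v - 1) = inverse (padic_p :: 'p padic)"
        using power_int_add[of "padic_p :: 'p padic" "v - k" "int (nat (k - v - 1))"]
        unfolding kv by (simp only: power_int_of_nat power_int_minus power_int_1_right) simp
      finally show False using padic_p_inverse_not_integer by blast
    qed
  qed
  have "padic_val x = v"
    unfolding padic_val_def * by (rule Greatest_equality) auto
  with * show ?thesis by simp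
qed

lemma padic_abs_le_iff:
  "padic_abs (x :: 'p::prime_card padic) \<le> real CARD('p) powi (- k)
     \<longleftrightarrow> x * padic_p powi (- k) \<in> padic_integers"
proof (cases "x = 0")
  case False
  have "1 < real CARD('p)" using card_prime_gt_1[where 'p='p] by simp
  then have "real CARD('p) powi (- padic_val x) \<le> real CARD('p) powi (- k) \<longleftrightarrow> k \<le> padic_val x"
    using power_int_increasing[of "- padic_val x" "- k" "real CARD('p)"]
      power_int_strict_increasing[of "- k" "- padic_val x" "real CARD('p)"] by force
  then show ?thesis
    using False by (simp add: padic_val_iff padic_abs_def)
qed (simp add: padic_abs_def padic_integers_closed)

lemma padic_abs_nonneg: "padic_abs x \<ge> 0"
  by (simp add: padic_abs_def)

lemma padic_abs_eq_0_iff: "padic_abs (x :: 'p::prime_card padic) = 0 \<longleftrightarrow> x = 0"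
  using card_prime_gt_1[where 'p='p] by (simp add: padic_abs_def)

lemma padic_abs_minus: "padic_abs (- x) = padic_abs x"
proof -
  have "- x * a \<in> padic_integers \<longleftrightarrow> x * a \<in> padic_integers" for a :: "'a padic"
    using padic_integers_closed(6) by force
  then show ?thesis by (simp add: padic_abs_def padic_val_def)
qed

lemma padic_abs_ultrametric: "padic_abs (x + y) \<le> max (padic_abs x) (padic_abs (y :: 'p::prime_card padic))"
proof -
  have *: "padic_abs (x + y) \<le> padic_abs x" if le: "padic_abs y \<le> padic_abs x" for x y :: "'p padic"
  proof (cases "x = 0")
    case True
    then have "y = 0" using le padic_abs_nonneg[of y] padic_abs_eq_0_iff[of y] by (simp add: padic_abs_def)
    with True show ?thesis by simp
  next
    case False
    then have x: "padic_abs x = real CARD('p) powi (- padic_val x)" by (simp add: padic_abs_def)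
    have "x * padic_p powi (- padic_val x) \<in> padic_integers"
      "y * padic_p powi (- padic_val x) \<in> padic_integers"
      using le x by (simp_all flip: padic_abs_le_iff)
    then have "(x + y) * padic_p powi (- padic_val x) \<in> padic_integers"
      by (simp add: distrib_right padic_integers_closed)
    then show ?thesis unfolding x by (simp add: padic_abs_le_iff)
  qed
  show ?thesis
    using *[of y x] *[of x y] by (cases "padic_abs y \<le> padic_abs x") (auto simp: add.commute)
qed

instantiation padic :: (prime_card) metric_space
begin

definition dist_padic :: "'a padic \<Rightarrow> 'a padic \<Rightarrow> real" where
  "dist x y = padic_abs (x - y)"

definition uniformity_padic_def:
  "(uniformity :: ('a padic \<times> 'a padic) filter) = (INF e\<in>{0<..}. principal {(x, y). dist x y < e})"

definition open_padic_def:
  "open (U :: 'a padic set) \<longleftrightarrow> (\<forall>x\<in>U. eventually (\<lambda>(x', y). x' = x \<longrightarrow> y \<in> U) uniformity)"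

instance
proof
  fix x y z :: "'a padic"
  show "dist x y = 0 \<longleftrightarrow> x = y"
    by (simp add: dist_padic_def padic_abs_eq_0_iff)
  have "dist x y \<le> max (padic_abs (x - z)) (padic_abs (z - y))"
    using padic_abs_ultrametric[of "x - z" "z - y"] by (simp add: dist_padic_def)
  also have "\<dots> \<le> dist x z + dist y z"
    using padic_abs_minus[of "y - z"] padic_abs_nonneg[of "x - z"] padic_abs_nonneg[of "y - z"]
    by (simp add: dist_padic_def)
  finally show "dist x y \<le> dist x z + dist y z" .
qed (simp_all add: uniformity_padic_def open_padic_def)

end

text \<open>Matrices are square matrices over the \<open>p\<close>-adic numbers with the product topology;
  \<open>n\<close> is the cardinality of the index type \<open>'n\<close>.\<close>

type_synonym ('p, 'n) padic_matrix = "(('p padic, 'n) vec, 'n) vec"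

definition integral_matrices :: "('p::prime_card, 'n::finite) padic_matrix set" where
  "integral_matrices = {A. \<forall>i j. A $ i $ j \<in> padic_integers}"

definition integral_GL :: "('p::prime_card, 'n::finite) padic_matrix set" where
  "integral_GL = {A \<in> integral_matrices. \<exists>B \<in> integral_matrices. A ** B = mat 1 \<and> B ** A = mat 1}"

definition normalized_haar :: "('p::prime_card, 'n::finite) padic_matrix measure \<Rightarrow> bool" where
  "normalized_haar vol \<longleftrightarrow>
     sigma_finite_measure vol \<and> sets vol = sets borel \<and>
     (\<forall>c. \<forall>S \<in> sets vol. emeasure vol ((+) c ` S) = emeasure vol S) \<and>
     emeasure vol integral_matrices = 1"

text \<open>\<open>p_neg_power k\<close> is \<open>p\<^bsup>-k\<^esup>\<close>, with value \<open>0\<close> at \<open>k = -\<infinity>\<close>; the value at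
  \<open>+\<infinity>\<close> is never used.\<close>

fun p_neg_power :: "int extended \<Rightarrow> 'p::prime_card padic" where
  "p_neg_power (Fin k) = padic_p powi (- k)"
| "p_neg_power Minf = 0"
| "p_neg_power Pinf = undefined"

definition diagonal_exponents ::
  "('p::prime_card, 'n::{finite,linorder}) padic_matrix \<Rightarrow> ('n \<Rightarrow> int extended) \<Rightarrow> bool" where
  "diagonal_exponents z k \<longleftrightarrow>
     antimono k \<and> (\<forall>j. k j \<noteq> Pinf) \<and>
     (\<exists>A \<in> integral_GL. \<exists>B \<in> integral_GL.
        z = A ** (\<chi> i j. if i = j then p_neg_power (k i) else 0) ** B)"

text \<open>The exponents exist and are determined by \<open>z\<close>, so the choice is unique.\<close>

definition exponents :: "('p::prime_card, 'n::{finite,linorder}) padic_matrix \<Rightarrow> 'n \<Rightarrow> int extended" where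
  "exponents z = (SOME k. diagonal_exponents z k)"

definition gamma :: "('p::prime_card, 'n::{finite,linorder}) padic_matrix \<Rightarrow> real" where
  "gamma z = (\<Prod>j | exponents z j > Fin 0. case exponents z j of Fin k \<Rightarrow> real CARD('p) powi k)"

end

theory Submission
  imports Defs
begin

text \<open>
  Let \<open>\<O>\<close> be the ring of \<open>p\<close>-adic integers. The Smith normal form shows that \<open>gamma z\<close> is the index of
  \<open>\<O>\<^sup>n\<close> in the lattice \<open>\<O>\<^sup>n + z \<O>\<^sup>n\<close>, which depends only on the coset of \<open>z\<close> modulo integral matrices. As
  every such coset has volume \<open>1\<close>, the integral is the sum of \<open>gamma\<^bsup>-\<alpha>\<^esup>\<close> over \<open>n\<close>-tuples of columns
  modulo \<open>\<O>\<^sup>n\<close>. Adding the columns one at a time, suppose that the columns so far generate the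
  lattice \<open>L = g \<O>\<^sup>n\<close> and the next one is \<open>v\<close>. Every class of \<open>v\<close> modulo \<open>L\<close> splits into \<open>[L : \<O>\<^sup>n]\<close> classes
  modulo \<open>\<O>\<^sup>n\<close>, and \<open>[L + \<O>v : L] = [\<O>\<^sup>n + \<O>u : \<O>\<^sup>n]\<close> for \<open>v = g u\<close>. Hence the sum over \<open>v\<close> is
  \<open>[L : \<O>\<^sup>n]\<^bsup>1-\<alpha>\<^esup>\<close> times the sum for a single column, and the total is a product of single
  column sums with exponents \<open>\<alpha>, \<alpha> - 1, \<dots>, \<alpha> - n + 1\<close>. Each of them is a geometric series.
\<close>

section \<open>Cosets of the \<open>p\<close>-adic integers\<close>

text \<open>A nonzero element is \<open>p^k\<close> times a unit, and the sign of \<open>k\<close>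
  decides the alternative. So any two elements are comparable under divisibility by \<O>, which is
  what produces pivots later.\<close>

lemma padic_valuation_ring:
  "(x :: 'p::prime_card padic) \<in> padic_integers \<or> inverse x \<in> padic_integers"
proof (cases "x = 0")
  case False
  obtain k u where u: "x = padic_p powi k * u" "u \<in> padic_integers" "inverse u \<in> padic_integers"
    using padic_factor[OF False] .
  show ?thesis
  proof (cases "k \<ge> 0")
    case True
    then have "x = padic_p ^ nat k * u" by (simp add: u(1) power_int_def)
    with u show ?thesis by (simp add: padic_integers_closed padic_integers_power)
  next
    case False
    then have "inverse x = padic_p ^ nat (- k) * inverse u"
      by (simp add: u(1) power_int_def power_inverse)
    with u show ?thesis by (metis padic_integers_closed(3,7) padic_integers_power)
  qed
qed (simp add: padic_integers_closed)

lemma padic_integers_sum: "(\<And>i. i \<in> S \<Longrightarrow> f i \<in> padic_integers) \<Longrightarrow> sum f S \<in> padic_integers"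
  by (induction S rule: infinite_finite_induct) (auto intro: padic_integers_closed)

text \<open>Divisibility over \<O> is a total preorder, so a finite set has an element that divides
  all the others, namely one of largest absolute value. It serves as pivot for a vector and for a
  block of a matrix.\<close>

lemma ex_dominating_element:
  assumes "finite S" "S \<noteq> {}"
  shows "\<exists>b\<in>S. \<forall>a\<in>S. \<exists>c\<in>padic_integers. a = c * (b :: 'p::prime_card padic)"
  using assms
proof (induction rule: finite_ne_induct)
  case (singleton x)
  show ?case using padic_integers_closed(2) by force
next
  case (insert x F)
  then obtain b where b: "b \<in> F" "\<And>a. a \<in> F \<Longrightarrow> \<exists>c\<in>padic_integers. a = c * b" by blast
  consider c where "c \<in> padic_integers" "x = c * b" | c where "c \<in> padic_integers" "b = c * x"
  proof (cases "b = 0")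
    case True
    then show ?thesis using that(2)[of 0] by (simp add: padic_integers_closed)
  next
    case False
    from padic_valuation_ring[of "x / b"] show ?thesis
    proof
      assume "x / b \<in> padic_integers"
      with False show ?thesis by (intro that(1)[of "x / b"]) auto
    next
      assume *: "inverse (x / b) \<in> padic_integers"
      \<comment> \<open>For \<open>x = 0\<close> the quotient \<open>inverse (x / b)\<close> is 0 by
        convention and says nothing about \<open>b / x\<close>, so this case is split off.\<close>
      show ?thesis
      proof (cases "x = 0")
        case True
        then show ?thesis by (intro that(1)[of 0]) (auto simp: padic_integers_closed)
      next
        case False
        with * show ?thesis by (intro that(2)[of "b / x"]) (auto simp: field_simps)
      qed
    qed
  qed
  then show ?case
  proof cases
    case 1
    then show ?thesis using b by auto
  next
    case 2
    have "\<exists>c\<in>padic_integers. a = c * x" if "a \<in> insert x F" for a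
    proof (cases "a = x")
      case False
      with that obtain d where d: "d \<in> padic_integers" "a = d * b" using b(2)[of a] by auto
      then have "a = (d * c) * x" by (simp add: 2(2) mult.assoc)
      then show ?thesis using padic_integers_closed(7)[OF d(1) 2(1)] by blast
    qed (use padic_integers_closed(2) in force)
    then show ?thesis by blast
  qed
qed

lemma padic_p_power_dvd_of_nat:
  assumes "of_nat d = padic_p ^ k * c" "(c :: 'p::prime_card padic) \<in> padic_integers"
  shows "CARD('p) ^ k dvd d"
proof -
  obtain y :: "'p padic_int" where y: "c = of_padic_int y" using assms(2) by (auto simp: padic_integers_def)
  have "of_padic_int (of_nat d) = (of_padic_int (of_nat CARD('p) ^ k * y) :: 'p padic)"
    using assms(1) y by (simp add: padic_p_def)
  then have "of_nat d = (of_nat CARD('p) ^ k * y :: 'p padic_int)" by (simp only: of_padic_int_eq_iff)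
  then have "padic_residue (of_nat d :: 'p padic_int) k = 0"
    by (metis dvd_triv_left padic_int_dvd_iff)
  then have "int d mod int CARD('p) ^ k = 0" by (simp only: residue_of_nat)
  then have "int d mod int (CARD('p) ^ k) = 0" by simp
  then show ?thesis by (simp flip: int_dvd_int_iff add: mod_0_imp_dvd)
qed

text \<open>\<open>d\<close> is the residue of \<open>x\<close> of index \<open>k\<close>; the
  difference then has residue zero and is divisible by \<open>p^k\<close>.\<close>

lemma padic_integer_approx:
  assumes "(x :: 'p::prime_card padic) \<in> padic_integers"
  obtains d c where "d < CARD('p) ^ k" "c \<in> padic_integers" "x = of_nat d + padic_p ^ k * c"
proof -
  obtain y :: "'p padic_int" where y: "x = of_padic_int y" using assms(1) by (auto simp: padic_integers_def)
  define d where "d = nat (padic_residue y k)"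
  have d: "int d = padic_residue y k" using residue_range(1)[of y k] by (simp add: d_def)
  have "padic_residue (y - of_nat d) k = 0"
    using d residue_range[of y k] by (simp add: residue_simps residue_of_nat)
  then obtain c where c: "y - of_nat d = of_nat CARD('p) ^ k * c"
    by (auto dest: padic_int_dvd_iff[THEN iffD2] simp: dvd_def)
  then have "y = of_nat d + of_nat CARD('p) ^ k * c" by (simp add: algebra_simps)
  then have "x = of_nat d + padic_p ^ k * of_padic_int c" by (simp add: y padic_p_def)
  moreover have "d < CARD('p) ^ k"
  proof -
    have "int d < int (CARD('p) ^ k)" using d residue_range(2)[of y k] by simp
    then show ?thesis by linarith
  qed
  ultimately show ?thesis using that by (auto simp: padic_integers_def)
qed

section \<open>Representatives of the classes of p-adic numbers modulo \<O>\<close>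

definition frac_rep :: "'p::prime_card padic \<Rightarrow> 'p padic" where
  "frac_rep x = (SOME y. x - y \<in> padic_integers)"

lemma frac_rep_diff: "x - frac_rep x \<in> padic_integers"
  unfolding frac_rep_def by (rule someI[of _ x]) (simp add: padic_integers_closed)

text \<open>Congruent elements satisfy the same predicate in the choice that defines
  \<open>frac_rep\<close>, so they receive the same representative.\<close>

lemma frac_rep_eq_iff: "frac_rep x = frac_rep y \<longleftrightarrow> x - y \<in> padic_integers"
proof
  assume "frac_rep x = frac_rep y"
  then show "x - y \<in> padic_integers"
    using padic_integers_closed(5)[OF frac_rep_diff[of x] frac_rep_diff[of y]] by simp
next
  assume xy: "x - y \<in> padic_integers"
  have "x - z \<in> padic_integers \<longleftrightarrow> y - z \<in> padic_integers" for z
    using padic_integers_closed(5)[OF _ xy, of "x - z"] padic_integers_closed(4)[OF _ xy, of "y - z"]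
    by auto
  then show "frac_rep x = frac_rep y" by (simp add: frac_rep_def)
qed

lemma frac_rep_idem [simp]: "frac_rep (frac_rep x) = frac_rep x"
  using padic_integers_closed(6)[OF frac_rep_diff[of x]] by (simp add: frac_rep_eq_iff)

text \<open>The group \<open>p^(-k) \<O> / \<O>\<close> is cyclic of order \<open>p^k\<close>, its
  classes being those of the fractions \<open>d / p^k\<close> with \<open>d < p^k\<close>. Every
  index below is computed from this count.\<close>

lemma card_frac_reps:
  "card {x :: 'p::prime_card padic. frac_rep x = x \<and> padic_p ^ k * x \<in> padic_integers} = CARD('p) ^ k"
proof -
  let ?f = "\<lambda>d::nat. frac_rep (of_nat d / padic_p ^ k) :: 'p padic"
  have "bij_betw ?f {..<CARD('p) ^ k} {x. frac_rep x = x \<and> padic_p ^ k * x \<in> padic_integers}"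
    unfolding bij_betw_def
  proof
    show "inj_on ?f {..<CARD('p) ^ k}"
    proof (rule linorder_inj_onI)
      fix a b assume ab: "a < b" "b \<in> {..<CARD('p) ^ k}" 
      show "?f a \<noteq> ?f b"
      proof
        assume "?f a = ?f b"
        then have "of_nat b / padic_p ^ k - of_nat a / padic_p ^ k \<in> (padic_integers :: 'p padic set)"
          using frac_rep_eq_iff by metis
        moreover have "of_nat (b - a) = padic_p ^ k * (of_nat b / padic_p ^ k - of_nat a / padic_p ^ k :: 'p padic)"
          using ab by (simp add: of_nat_diff field_simps)
        ultimately have "CARD('p) ^ k dvd b - a" by (metis padic_p_power_dvd_of_nat)
        then show False using ab by (auto dest: dvd_imp_le)
      qed
    qed auto
    have "?f d \<in> {x. frac_rep x = x \<and> padic_p ^ k * x \<in> padic_integers}" for d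
    proof -
      have "of_nat d / padic_p ^ k - ?f d \<in> padic_integers" by (rule frac_rep_diff)
      then have "padic_p ^ k * (of_nat d / padic_p ^ k - ?f d) \<in> padic_integers"
        by (intro padic_integers_closed(7) padic_integers_closed(3) padic_integers_power)
      then have "of_nat d - padic_p ^ k * ?f d \<in> padic_integers"
        by (simp add: right_diff_distrib)
      moreover have "of_nat d \<in> (padic_integers :: 'p padic set)"
        unfolding padic_integers_def by (metis of_padic_int_of_nat rangeI)
      ultimately have "of_nat d - (of_nat d - padic_p ^ k * ?f d) \<in> padic_integers"
        by (metis padic_integers_closed(5))
      then show ?thesis by simp
    qed
    moreover have "x \<in> ?f ` {..<CARD('p) ^ k}" if x: "frac_rep x = x" "padic_p ^ k * x \<in> padic_integers" for x
    proof -
      obtain d c where d: "d < CARD('p) ^ k" "c \<in> padic_integers" "padic_p ^ k * x = of_nat d + padic_p ^ k * c"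
        using padic_integer_approx[OF x(2)] .
      then have "x - of_nat d / padic_p ^ k = c" by (simp add: field_simps)
      then have "frac_rep x = ?f d" using d(2) by (simp only: frac_rep_eq_iff)
      with x d show ?thesis by auto
    qed
    ultimately show "?f ` {..<CARD('p) ^ k} = {x. frac_rep x = x \<and> padic_p ^ k * x \<in> padic_integers}"
      by auto
  qed
  then show ?thesis by (auto dest: bij_betw_same_card)
qed

lemma finite_frac_reps:
  "finite {x :: 'p::prime_card padic. frac_rep x = x \<and> padic_p ^ k * x \<in> padic_integers}"
  by (rule card_ge_0_finite) (simp add: card_frac_reps)

lemma padic_p_power_multiple_integral: "\<exists>k. padic_p ^ k * (x :: 'p::prime_card padic) \<in> padic_integers"
proof (cases "x = 0")
  case False
  obtain k u where u: "x = padic_p powi k * u" "u \<in> padic_integers"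
    using padic_factor[OF False] by metis
  show ?thesis
  proof (cases "k \<ge> 0")
    case True
    then have "x = padic_p ^ nat k * u" by (simp add: u(1) power_int_def)
    with u show ?thesis by (intro exI[of _ 0]) (simp add: padic_integers_closed padic_integers_power)
  next
    case False
    then have "padic_p ^ nat (-k) * x = u" by (simp add: u(1) power_int_def power_inverse)
    then show ?thesis using u by metis
  qed
qed (simp add: padic_integers_closed)

text \<open>The field is the union of the groups \<open>p^(-k) \<O>\<close>, each of which has
  finitely many classes modulo \<O>.\<close>

lemma countable_frac_reps: "countable {x :: 'p::prime_card padic. frac_rep x = x}"
proof -
  have "{x :: 'p::prime_card padic. frac_rep x = x} =
      (\<Union>k. {x. frac_rep x = x \<and> padic_p ^ k * x \<in> padic_integers})"
    using padic_p_power_multiple_integral by auto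
  then show ?thesis by (auto intro: countable_finite finite_frac_reps)
qed

section \<open>Lattices and their indices\<close>

text \<open>Tonelli for sums: indicators extend both sums to the whole types. The second component
  ends up as the outer variable.\<close>

lemma nn_integral_count_space_Times:
  "(\<integral>\<^sup>+z. f z \<partial>count_space (A \<times> B)) = (\<integral>\<^sup>+y. \<integral>\<^sup>+x. f (x, y) \<partial>count_space A \<partial>count_space B)"
proof -
  have "(\<integral>\<^sup>+z. f z \<partial>count_space (A \<times> B)) = (\<integral>\<^sup>+z. f z * indicator (A \<times> B) z \<partial>count_space UNIV)"
    by (rule nn_integral_count_space_indicator) simp
  also have "\<dots> = (\<integral>\<^sup>+y. \<integral>\<^sup>+x. f (x, y) * indicator (A \<times> B) (x, y) \<partial>count_space UNIV \<partial>count_space UNIV)"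
    by (rule nn_integral_snd_count_space[symmetric])
  also have "\<dots> = (\<integral>\<^sup>+y. (\<integral>\<^sup>+x. f (x, y) * indicator A x \<partial>count_space UNIV) * indicator B y \<partial>count_space UNIV)"
    by (subst nn_integral_multc[symmetric]) (simp_all add: indicator_times mult_ac)
  finally show ?thesis by (simp add: nn_integral_count_space_indicator)
qed

text \<open>For negative \<open>k\<close>, multiplying by the power \<open>- k - 1\<close> of
  \<open>padic_p\<close> would make \<open>inverse padic_p\<close> integral.\<close>

lemma padic_p_powi_integral_iff:
  "padic_p powi k \<in> (padic_integers :: 'p::prime_card padic set) \<longleftrightarrow> 0 \<le> k"
proof
  assume "0 \<le> k"
  then show "padic_p powi k \<in> (padic_integers :: 'p padic set)"
    by (simp add: power_int_def padic_integers_closed padic_integers_power)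
next
  assume P: "padic_p powi k \<in> (padic_integers :: 'p padic set)"
  show "0 \<le> k"
  proof (rule ccontr)
    assume "\<not> 0 \<le> k"
    then have "k + int (nat (- k - 1)) = - 1" by simp
    then have "padic_p powi k * padic_p ^ nat (- k - 1) = inverse (padic_p :: 'p padic)"
      using power_int_add[of "padic_p :: 'p padic" k "int (nat (- k - 1))"]
      by (simp only: power_int_of_nat power_int_minus power_int_1_right) simp
    moreover have "padic_p powi k * padic_p ^ nat (- k - 1) \<in> (padic_integers :: 'p padic set)"
      using P by (intro padic_integers_closed(7) padic_integers_power padic_integers_closed(3))
    ultimately show False using padic_p_inverse_not_integer by metis
  qed
qed

section \<open>Vectors modulo integral vectors\<close>

definition integral_vectors :: "('p::prime_card padic, 'n::finite) vec set" where
  "integral_vectors = {x. \<forall>i. x $ i \<in> padic_integers}"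

definition vec_rep :: "('p::prime_card padic, 'n::finite) vec \<Rightarrow> ('p padic, 'n) vec" where
  "vec_rep x = (\<chi> i. frac_rep (x $ i))"

definition vec_reps :: "('p::prime_card padic, 'n::finite) vec set" where
  "vec_reps = {x. vec_rep x = x}"

text \<open>For a lattice \<open>L\<close> containing \<open>\<O>\<^sup>n\<close>, \<open>lat_index L\<close> is the index of \<open>\<O>\<^sup>n\<close> in \<open>L\<close>.\<close>

definition lat_index :: "('p::prime_card padic, 'n::finite) vec set \<Rightarrow> ennreal" where
  "lat_index L = emeasure (count_space vec_reps) (vec_reps \<inter> L)"

text \<open>Automorphisms of the vector space, kept as functions: lattices are the images of
  \<open>integral_vectors\<close> under them, and composition is available directly.\<close>

definition lin_bij :: "(('p::prime_card padic, 'n::finite) vec \<Rightarrow> ('p padic, 'n) vec) \<Rightarrow> bool" where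
  "lin_bij g \<longleftrightarrow> (\<forall>x y. g (x + y) = g x + g y) \<and> (\<forall>c x. g (c *s x) = c *s g x) \<and> bij g"

definition adjoin :: "('p::prime_card padic, 'n::finite) vec set \<Rightarrow> ('p padic, 'n) vec \<Rightarrow> ('p padic, 'n) vec set" where
  "adjoin L v = {l + c *s v | l c. l \<in> L \<and> c \<in> padic_integers}"

lemma integral_vectors_closed:
  "0 \<in> integral_vectors"
  "x \<in> integral_vectors \<Longrightarrow> y \<in> integral_vectors \<Longrightarrow> x + y \<in> integral_vectors"
  "x \<in> integral_vectors \<Longrightarrow> y \<in> integral_vectors \<Longrightarrow> x - y \<in> integral_vectors"
  "x \<in> integral_vectors \<Longrightarrow> - x \<in> integral_vectors"
  "c \<in> padic_integers \<Longrightarrow> x \<in> integral_vectors \<Longrightarrow> c *s x \<in> integral_vectors"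
  by (auto simp: integral_vectors_def intro: padic_integers_closed)

lemma vec_rep_diff: "x - vec_rep x \<in> integral_vectors"
  by (simp add: vec_rep_def integral_vectors_def frac_rep_diff)

lemma vec_rep_eq_iff: "vec_rep x = vec_rep y \<longleftrightarrow> x - y \<in> integral_vectors"
  by (simp add: vec_rep_def vec_eq_iff integral_vectors_def frac_rep_eq_iff)

lemma vec_rep_in_reps [simp]: "vec_rep x \<in> vec_reps"
  by (simp add: vec_rep_def vec_reps_def vec_eq_iff)

lemma vec_reps_eqI: "x \<in> vec_reps \<Longrightarrow> y \<in> vec_reps \<Longrightarrow> x - y \<in> integral_vectors \<Longrightarrow> x = y"
  by (metis (mono_tags) vec_rep_eq_iff vec_reps_def mem_Collect_eq)

lemma lin_bijD:
  assumes "lin_bij g"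
  shows "g (x + y) = g x + g y" "g (c *s x) = c *s g x" "g (x - y) = g x - g y" "g 0 = 0" "bij g"
proof -
  show add: "g (x + y) = g x + g y" for x y using assms by (simp add: lin_bij_def)
  show "g (c *s x) = c *s g x" "bij g" using assms by (simp_all add: lin_bij_def)
  show "g (x - y) = g x - g y" using add[of "x - y" y] by simp
  show "g 0 = 0" using add[of 0 0] by simp
qed

lemma lin_bij_image_mem_iff: "lin_bij g \<Longrightarrow> g x \<in> g ` L \<longleftrightarrow> x \<in> L"
  by (meson bij_is_inj inj_image_mem_iff lin_bijD(5))

lemma lin_bij_comp: "lin_bij f \<Longrightarrow> lin_bij g \<Longrightarrow> lin_bij (f \<circ> g)"
  by (auto simp: lin_bij_def bij_comp)

lemma lat_index_eq_nn_integral: "lat_index L = (\<integral>\<^sup>+v. indicator L v \<partial>count_space vec_reps)"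
proof -
  have "(\<integral>\<^sup>+v. indicator L v \<partial>count_space vec_reps) = (\<integral>\<^sup>+v. indicator (vec_reps \<inter> L) v \<partial>count_space vec_reps)"
    by (rule nn_integral_cong) (simp split: split_indicator)
  then show ?thesis by (simp add: lat_index_def)
qed

lemma nn_integral_reps_sublattice:
  fixes h :: "('p::prime_card padic, 'n::finite) vec \<Rightarrow> ennreal"
  assumes g: "lin_bij g" and sub: "integral_vectors \<subseteq> g ` integral_vectors"
    and per: "\<And>v l. l \<in> g ` integral_vectors \<Longrightarrow> h (v + l) = h v"
  shows "(\<integral>\<^sup>+v. h v \<partial>count_space vec_reps) =
    lat_index (g ` integral_vectors) * (\<integral>\<^sup>+u. h (g u) \<partial>count_space vec_reps)"
proof -
  \<comment> \<open>A coset of \<open>\<O>\<^sup>n\<close> is a coset of \<open>L = g \<O>\<^sup>n\<close> together with an element of \<open>L / \<O>\<^sup>n\<close>;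
    \<open>g\<close> carries the representatives of \<open>V / \<O>\<^sup>n\<close> to representatives of \<open>V / L\<close>.\<close>
  let ?L = "g ` integral_vectors" and ?f = "\<lambda>(s, r). vec_rep (g s + r)"
  have L_add: "x + y \<in> ?L" and L_diff: "x - y \<in> ?L" if "x \<in> ?L" "y \<in> ?L" for x y
    using that by (force simp: lin_bijD(1,3)[OF g, symmetric] intro: integral_vectors_closed)+
  have bij: "bij_betw ?f (vec_reps \<times> (vec_reps \<inter> ?L)) vec_reps"
    unfolding bij_betw_def
  proof
    show "inj_on ?f (vec_reps \<times> (vec_reps \<inter> ?L))"
    proof (rule inj_onI)
      fix z z' assume z: "z \<in> vec_reps \<times> (vec_reps \<inter> ?L)" "z' \<in> vec_reps \<times> (vec_reps \<inter> ?L)" "?f z = ?f z'"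
      obtain s r s' r' where sr: "z = (s, r)" "z' = (s', r')" by fastforce
      with z have s: "s \<in> vec_reps" "s' \<in> vec_reps" and r: "r \<in> vec_reps" "r' \<in> vec_reps"
        and l: "r \<in> ?L" "r' \<in> ?L" and eq: "vec_rep (g s + r) = vec_rep (g s' + r')"
        by simp_all
      \<comment> \<open>Read modulo \<open>?L\<close>, this congruence loses \<open>r\<close> and
        \<open>r'\<close> and yields \<open>s = s'\<close>; the same congruence then reduces to
        \<open>r - r'\<close> and gives \<open>r = r'\<close>.\<close>
      have d: "(g s + r) - (g s' + r') \<in> integral_vectors" using eq by (simp add: vec_rep_eq_iff)
      then have "(g s + r) - (g s' + r') \<in> ?L" using sub by blast
      moreover have "r' - r \<in> ?L" using l by (intro L_diff)
      ultimately have "((g s + r) - (g s' + r')) + (r' - r) \<in> ?L" by (rule L_add)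
      then have "g (s - s') \<in> ?L" by (simp add: lin_bijD[OF g] algebra_simps)
      then have "s - s' \<in> integral_vectors" by (simp add: lin_bij_image_mem_iff[OF g])
      then have "s = s'" using s by (intro vec_reps_eqI)
      moreover from this have "r = r'" using d r by (intro vec_reps_eqI) auto
      ultimately show "z = z'" by (simp add: sr)
    qed
    have "v \<in> ?f ` (vec_reps \<times> (vec_reps \<inter> ?L))" if v: "v \<in> vec_reps" for v
    proof -
      obtain x where x: "v = g x" using lin_bijD(5)[OF g] by (metis bij_pointE)
      \<comment> \<open>The class of \<open>v\<close> modulo \<open>?L\<close> is stripped off by
        \<open>g (vec_rep x)\<close>; the remainder lies in \<open>?L\<close> and is reduced modulo
        \<O>^n.\<close>
      define r where "r = vec_rep (v - g (vec_rep x))"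
      have "v - g (vec_rep x) \<in> ?L"
        unfolding x by (simp add: lin_bijD(3)[OF g, symmetric] lin_bij_image_mem_iff[OF g] vec_rep_diff)
      moreover have dr: "(v - g (vec_rep x)) - r \<in> integral_vectors" unfolding r_def by (rule vec_rep_diff)
      ultimately have "(v - g (vec_rep x)) - ((v - g (vec_rep x)) - r) \<in> ?L"
        using sub by (metis L_diff subsetD)
      then have "r \<in> ?L" by simp
      moreover have "vec_rep (g (vec_rep x) + r) = v"
      proof -
        have "vec_rep (g (vec_rep x) + r) = vec_rep v"
          using integral_vectors_closed(4)[OF dr] by (simp add: vec_rep_eq_iff algebra_simps)
        with v show ?thesis by (simp add: vec_reps_def)
      qed
      ultimately show ?thesis by (intro image_eqI[of _ _ "(vec_rep x, r)"]) (auto simp: r_def)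
    qed
    then show "?f ` (vec_reps \<times> (vec_reps \<inter> ?L)) = vec_reps" by auto
  qed
  \<comment> \<open>Passing to the representative changes the argument by an integral vector;
    together with \<open>r\<close> this is an element of \<open>?L\<close>, a period of
    \<open>h\<close>.\<close>
  have h: "h (?f (s, r)) = h (g s)" if "r \<in> ?L" for s r
  proof -
    have "vec_rep (g s + r) = g s + (r - ((g s + r) - vec_rep (g s + r)))" by simp
    also have "h \<dots> = h (g s)"
    proof (rule per)
      have "(g s + r) - vec_rep (g s + r) \<in> ?L" using sub vec_rep_diff by (rule subsetD)
      with that show "r - ((g s + r) - vec_rep (g s + r)) \<in> ?L" by (rule L_diff)
    qed
    finally show ?thesis by simp
  qed
  have "(\<integral>\<^sup>+v. h v \<partial>count_space vec_reps) = (\<integral>\<^sup>+z. h (?f z) \<partial>count_space (vec_reps \<times> (vec_reps \<inter> ?L)))"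
    by (rule nn_integral_bij_count_space[OF bij, symmetric])
  also have "\<dots> = (\<integral>\<^sup>+r. \<integral>\<^sup>+s. h (?f (s, r)) \<partial>count_space vec_reps \<partial>count_space (vec_reps \<inter> ?L))"
    by (rule nn_integral_count_space_Times)
  also have "\<dots> = (\<integral>\<^sup>+r. \<integral>\<^sup>+s. h (g s) \<partial>count_space vec_reps \<partial>count_space (vec_reps \<inter> ?L))"
    by (intro nn_integral_cong h) simp
  finally show ?thesis by (simp add: lat_index_def emeasure_count_space mult.commute)
qed

text \<open>For lattices this is multiplicativity of the index along \<O>^n,
  \<open>g \<O>^n\<close>, \<open>g L\<close>. It is \<open>nn_integral_reps_sublattice\<close> for
  the indicator of \<open>g L\<close>, which is periodic because \<open>L\<close> absorbs integral
  vectors.\<close>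

lemma lat_index_image:
  assumes g: "lin_bij g" and "integral_vectors \<subseteq> g ` integral_vectors"
    and add: "\<And>x y. x \<in> L \<Longrightarrow> y \<in> integral_vectors \<Longrightarrow> x + y \<in> L"
  shows "lat_index (g ` L) = lat_index (g ` integral_vectors) * lat_index L"
proof -
  have "indicator (g ` L) (v + l) = (indicator (g ` L) v :: ennreal)" if l: "l \<in> g ` integral_vectors" for v l
  proof -
    obtain x where "v = g x" using surjD[OF bij_is_surj[OF lin_bijD(5)[OF g]]] by blast
    moreover obtain y where "l = g y" "y \<in> integral_vectors" using l by blast
    ultimately have x: "v = g x" "l = g y" "y \<in> integral_vectors" by auto
    have "x + y \<in> L \<longleftrightarrow> x \<in> L"
      using add[of x y] add[of "x + y" "- y"] x(3) by (auto dest: integral_vectors_closed(4))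
    then show ?thesis
      unfolding x lin_bijD(1)[OF g, symmetric] by (simp add: lin_bij_image_mem_iff[OF g] indicator_def)
  qed
  then show ?thesis
    using nn_integral_reps_sublattice[OF assms(1,2), of "indicator (g ` L)"]
    by (simp add: lat_index_eq_nn_integral lin_bij_image_mem_iff[OF g] indicator_def)
qed

text \<open>The only representative inside \<O>^n is that of 0, which the choice in
  \<open>frac_rep\<close> need not make equal to 0.\<close>

lemma lat_index_integral_vectors: "lat_index integral_vectors = 1"
proof -
  have rep0: "vec_rep 0 \<in> integral_vectors"
    using integral_vectors_closed(4)[OF vec_rep_diff[of 0]] by simp
  have "v = vec_rep 0" if "v \<in> vec_reps" "v \<in> integral_vectors" for v
    using that rep0 by (intro vec_reps_eqI) (auto intro: integral_vectors_closed)
  with rep0 have eq: "vec_reps \<inter> integral_vectors = {vec_rep 0}" by auto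
  show ?thesis unfolding lat_index_def eq by simp
qed

section \<open>Adjoining one vector to the standard lattice\<close>

lemma subset_adjoin: "L \<subseteq> adjoin L v"
  unfolding adjoin_def using padic_integers_closed(1)
  by (intro subsetI CollectI, rule_tac x=x in exI, rule_tac x=0 in exI) simp

lemma adjoin_integral:
  assumes "u \<in> integral_vectors"
  shows "adjoin integral_vectors u = integral_vectors"
proof
  show "adjoin integral_vectors u \<subseteq> integral_vectors"
    using assms by (auto simp: adjoin_def intro: integral_vectors_closed)
  show "integral_vectors \<subseteq> adjoin integral_vectors u" by (rule subset_adjoin)
qed

text \<open>Smith normal form of a single column. If \<open>u\<close> is not integral, an entry
  \<open>u $ i\<close> dividing all the others has absolute value \<open>p^m\<close>, and this entry
  alone governs the index and the multiples of \<open>u\<close> that are integral. Integral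
  \<open>u\<close> give \<open>m = 0\<close>.\<close>

lemma adjoin_standard_lattice:
  fixes u :: "('p::prime_card padic, 'n::finite) vec"
  shows "\<exists>g m. lin_bij g \<and> adjoin integral_vectors u = g ` integral_vectors
    \<and> lat_index (adjoin integral_vectors u) = ennreal (real CARD('p) ^ m)
    \<and> (\<forall>k. padic_p ^ k *s u \<in> integral_vectors \<longleftrightarrow> m \<le> k)"
proof (cases "u \<in> integral_vectors")
  case True
  then show ?thesis
    by (intro exI[of _ "\<lambda>x. x"] exI[of _ 0])
      (auto simp: lin_bij_def adjoin_integral lat_index_integral_vectors bij_betw_def
        intro: integral_vectors_closed padic_integers_closed padic_integers_power)
next
  case False
  obtain i where "\<forall>j. \<exists>c\<in>padic_integers. u $ j = c * u $ i"
    using ex_dominating_element[of "range (\<lambda>j. u $ j)"] by auto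
  then obtain c where c: "\<And>j. c j \<in> padic_integers" "\<And>j. u $ j = c j * u $ i" by metis
  have ui: "u $ i \<notin> padic_integers"
  proof
    assume "u $ i \<in> padic_integers"
    then have "c j * u $ i \<in> padic_integers" for j using c(1) by (intro padic_integers_closed(7))
    then have "u \<in> integral_vectors" by (simp add: integral_vectors_def flip: c(2))
    with False show False by contradiction
  qed
  then have nz: "u $ i \<noteq> 0" using padic_integers_closed(1) by metis
  obtain k w where w: "u $ i = padic_p powi k * w" "w \<in> padic_integers" "inverse w \<in> padic_integers"
    using padic_factor[OF nz] .
  have w0: "w \<noteq> 0" using nz w(1) by auto
  define m where "m = nat (- k)"
  have k: "k < 0"
    using ui padic_p_powi_integral_iff[of k, where 'p='p] padic_integers_closed(7)[OF _ w(2)]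
    by (simp add: w(1)) (metis not_le)
  then have km: "k = - int m" by (simp add: m_def)
  have iff: "padic_p ^ j * u $ i \<in> padic_integers \<longleftrightarrow> m \<le> j" for j
  proof -
    have eq: "padic_p ^ j * u $ i = padic_p powi (int j + k) * w"
      by (simp add: w(1) power_int_add)
    have "padic_p ^ j * u $ i \<in> padic_integers \<longleftrightarrow> padic_p powi (int j + k) \<in> (padic_integers :: 'p padic set)"
      unfolding eq using padic_integers_closed(7)[OF _ w(2)] padic_integers_closed(7)[OF _ w(3)] w0
      by (metis mult.assoc mult.right_neutral right_inverse)
    also have "\<dots> \<longleftrightarrow> m \<le> j" by (auto simp: padic_p_powi_integral_iff km)
    finally show ?thesis .
  qed
  have multiple: "\<exists>d\<in>padic_integers. t = d * u $ i" if "padic_p ^ m * t \<in> padic_integers" for t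
  proof
    show "padic_p ^ m * t * inverse w \<in> padic_integers" using that w(3) by (rule padic_integers_closed)
    show "t = padic_p ^ m * t * inverse w * u $ i"
      using w0 by (simp add: w(1) km power_int_minus field_simps)
  qed
  \<comment> \<open>\<open>g\<close> sends the \<open>i\<close>-th basis vector to \<open>u\<close>
    and fixes the other basis vectors.\<close>
  define e where "e = u - axis i 1"
  define g where "g x = x + (x $ i) *s e" for x
  have e_nth: "e $ j = u $ j - (if j = i then 1 else 0)" for j by (simp add: e_def axis_def)
  \<comment> \<open>Since \<open>g x $ i = x $ i * u $ i\<close>, the coefficient of
    \<open>e\<close> is recovered from \<open>y = g x\<close> as
    \<open>y $ i / u $ i\<close>.\<close>
  have "bij g"
    by (rule bij_betw_byWitness[where f' = "\<lambda>y. y - (y $ i / u $ i) *s e"])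
      (use nz in \<open>auto simp: g_def vec_eq_iff e_nth field_simps\<close>)
  then have lin: "lin_bij g"
    by (auto simp: lin_bij_def g_def vec_eq_iff algebra_simps)
  have im: "adjoin integral_vectors u = g ` integral_vectors"
  proof
    show "g ` integral_vectors \<subseteq> adjoin integral_vectors u"
    proof
      fix y assume "y \<in> g ` integral_vectors"
      then obtain x where x: "x \<in> integral_vectors" "y = g x" by blast
      have "y = (x - x $ i *s axis i 1) + x $ i *s u"
        by (simp add: x(2) g_def e_def vec_eq_iff algebra_simps)
      moreover have "x - x $ i *s axis i 1 \<in> integral_vectors" "x $ i \<in> padic_integers"
        using x(1) by (auto simp: integral_vectors_def axis_def intro: padic_integers_closed)
      ultimately show "y \<in> adjoin integral_vectors u" by (auto simp: adjoin_def)
    qed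
    show "adjoin integral_vectors u \<subseteq> g ` integral_vectors"
    proof
      fix y assume "y \<in> adjoin integral_vectors u"
      then obtain x d where x: "x \<in> integral_vectors" "d \<in> padic_integers" "y = x + d *s u"
        by (auto simp: adjoin_def)
      define z where "z = y - (y $ i / u $ i) *s e"
      have "inverse (u $ i) \<in> padic_integers" using padic_valuation_ring[of "u $ i"] ui by simp
      then have q: "x $ i * inverse (u $ i) \<in> padic_integers"
        using x(1) by (auto simp: integral_vectors_def intro: padic_integers_closed)
      \<comment> \<open>Off \<open>i\<close> the contributions of \<open>d\<close> cancel. At
        \<open>i\<close> the first two terms cancel, as \<open>c i = 1\<close>, and what remains is
        integral because \<open>inverse (u $ i)\<close> is.\<close>
      have "z $ j = x $ j - x $ i * c j + (if j = i then d + x $ i * inverse (u $ i) else 0)" for j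
        using nz c(2)[of j] by (simp add: z_def x(3) e_nth field_simps)
      then have "z \<in> integral_vectors"
        using x(1,2) q c(1) by (auto simp: integral_vectors_def intro!: padic_integers_closed)
      moreover have "g z = y" using nz by (simp add: g_def z_def vec_eq_iff e_nth field_simps)
      ultimately show "y \<in> g ` integral_vectors" by blast
    qed
  qed
  \<comment> \<open>As \<open>u $ i\<close> divides every entry of \<open>u\<close>, a class modulo \<open>\<O>\<^sup>n\<close> in the lattice is determined by its \<open>i\<close>-th entry.\<close>
  let ?T = "{t :: 'p padic. frac_rep t = t \<and> padic_p ^ m * t \<in> padic_integers}"
  have "bij_betw (\<lambda>v. v $ i) (vec_reps \<inter> adjoin integral_vectors u) ?T"
    unfolding bij_betw_def
  proof
    show "inj_on (\<lambda>v. v $ i) (vec_reps \<inter> adjoin integral_vectors u)"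
    proof (rule inj_onI)
      fix v v' assume v: "v \<in> vec_reps \<inter> adjoin integral_vectors u" "v' \<in> vec_reps \<inter> adjoin integral_vectors u"
        "v $ i = v' $ i"
      obtain x d x' d' where x: "x \<in> integral_vectors" "v = x + d *s u" "x' \<in> integral_vectors" "v' = x' + d' *s u"
        using v by (auto simp: adjoin_def)
      have "(d - d') * u $ i = x' $ i - x $ i" using v(3) by (simp add: x algebra_simps)
      then have d: "(d - d') * u $ i \<in> padic_integers"
        using x by (auto simp: integral_vectors_def intro: padic_integers_closed)
      have "(v - v') $ j = (x $ j - x' $ j) + c j * ((d - d') * u $ i)" for j
        using c(2)[of j] by (simp add: x algebra_simps)
      then have "v - v' \<in> integral_vectors"
        using x(1,3) d c(1) by (auto simp: integral_vectors_def intro!: padic_integers_closed)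
      with v show "v = v'" by (intro vec_reps_eqI) auto
    qed
    have "v $ i \<in> ?T" if v: "v \<in> vec_reps \<inter> adjoin integral_vectors u" for v
    proof -
      obtain x d where x: "x \<in> integral_vectors" "v = x + d *s u" "d \<in> padic_integers"
        using v by (auto simp: adjoin_def)
      have "padic_p ^ m * v $ i = padic_p ^ m * x $ i + d * (padic_p ^ m * u $ i)"
        by (simp add: x algebra_simps)
      also have "\<dots> \<in> padic_integers"
        using x iff[of m] by (auto simp: integral_vectors_def intro!: padic_integers_closed padic_integers_power)
      finally show ?thesis using v by (auto simp: vec_reps_def vec_rep_def vec_eq_iff)
    qed
    moreover have "t \<in> (\<lambda>v. v $ i) ` (vec_reps \<inter> adjoin integral_vectors u)" if t: "t \<in> ?T" for t
    proof -
      obtain d where d: "d \<in> padic_integers" "t = d * u $ i" using multiple t by blast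
      have "vec_rep (d *s u) = - (d *s u - vec_rep (d *s u)) + d *s u" by simp
      then have "vec_rep (d *s u) \<in> adjoin integral_vectors u"
        unfolding adjoin_def using d(1) integral_vectors_closed(4)[OF vec_rep_diff] by blast
      moreover have "vec_rep (d *s u) $ i = t" using t by (simp add: vec_rep_def d(2))
      ultimately show ?thesis by (metis IntI image_eqI vec_rep_in_reps)
    qed
    ultimately show "(\<lambda>v. v $ i) ` (vec_reps \<inter> adjoin integral_vectors u) = ?T" by blast
  qed
  then have "card (vec_reps \<inter> adjoin integral_vectors u) = CARD('p) ^ m"
      "finite (vec_reps \<inter> adjoin integral_vectors u)"
    by (auto dest: bij_betw_same_card bij_betw_finite simp: card_frac_reps finite_frac_reps)
  then have "lat_index (adjoin integral_vectors u) = ennreal (real CARD('p) ^ m)"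
    by (simp add: lat_index_def emeasure_count_space ennreal_of_nat_eq_real_of_nat)
  moreover have "padic_p ^ j *s u \<in> integral_vectors \<longleftrightarrow> m \<le> j" for j
  proof -
    have "padic_p ^ j * u $ l = c l * (padic_p ^ j * u $ i)" for l
      by (subst c(2)[of l]) (simp add: ac_simps)
    then have "padic_p ^ j * u $ l \<in> padic_integers" if "padic_p ^ j * u $ i \<in> padic_integers" for l
      using padic_integers_closed(7)[OF c(1)[of l] that] by metis
    then have "padic_p ^ j *s u \<in> integral_vectors \<longleftrightarrow> padic_p ^ j * u $ i \<in> padic_integers"
      by (auto simp: integral_vectors_def)
    then show ?thesis by (simp add: iff)
  qed
  ultimately show ?thesis using lin im by blast
qed

section \<open>Sums over columns\<close>

lemma bij_betw_vec_nth: "bij_betw vec_nth {v. \<forall>i. v $ i \<in> S i} (PiE UNIV S)"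
  by (rule bij_betw_byWitness[where f' = vec_lambda]) auto

lemma lat_index_eq_card:
  "finite (vec_reps \<inter> L) \<Longrightarrow> lat_index L = ennreal (real (card (vec_reps \<inter> L)))"
  by (simp add: lat_index_def emeasure_count_space ennreal_of_nat_eq_real_of_nat)

text \<open>The box is a product of groups \<open>p^(-k i) \<O>\<close>, counted coordinatewise by
  \<open>card_frac_reps\<close>. It serves the single column sum with constant exponents and the
  index of a diagonal matrix with varying ones.\<close>

lemma lat_index_box:
  "lat_index {v :: ('p::prime_card padic, 'n::finite) vec. \<forall>i. padic_p ^ k i * v $ i \<in> padic_integers}
    = ennreal (\<Prod>i\<in>UNIV. real CARD('p) ^ k i)"
proof -
  let ?S = "\<lambda>i. {t :: 'p padic. frac_rep t = t \<and> padic_p ^ k i * t \<in> padic_integers}"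
  let ?A = "{v :: ('p padic, 'n) vec. \<forall>i. padic_p ^ k i * v $ i \<in> padic_integers}"
  have eq: "vec_reps \<inter> ?A = {v. \<forall>i. v $ i \<in> ?S i}"
    by (auto simp: vec_reps_def vec_rep_def vec_eq_iff)
  have "finite (PiE UNIV ?S)" by (intro finite_PiE) (simp_all add: finite_frac_reps)
  then have fin: "finite {v. \<forall>i. v $ i \<in> ?S i}" and card: "card {v. \<forall>i. v $ i \<in> ?S i} = (\<Prod>i\<in>UNIV. CARD('p) ^ k i)"
    using bij_betw_finite[OF bij_betw_vec_nth[of ?S]] bij_betw_same_card[OF bij_betw_vec_nth[of ?S]]
    by (simp_all add: card_PiE card_frac_reps)
  have "lat_index ?A = ennreal (real (card (vec_reps \<inter> ?A)))"
    by (rule lat_index_eq_card) (unfold eq, rule fin)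
  also have "card (vec_reps \<inter> ?A) = (\<Prod>i\<in>UNIV. CARD('p) ^ k i)" unfolding eq by (rule card)
  finally show ?thesis by simp
qed

text \<open>Writes \<open>x ^ m\<close> as a superposition of the conditions
  \<open>m \<le> k\<close>, which for an index \<open>q^m\<close> become membership in the boxes
  \<open>p^(-k) \<O>^n\<close>.\<close>

lemma geometric_tail_sums:
  fixes x :: real
  assumes "0 \<le> x" "x < 1"
  shows "(\<lambda>k. x ^ k * (1 - x) * (if m \<le> k then 1 else 0)) sums x ^ m"
proof -
  have "(\<lambda>k. x ^ m * (1 - x) * x ^ k) sums (x ^ m * (1 - x) * (1 / (1 - x)))"
    using assms by (intro sums_mult geometric_sums) simp
  then have "(\<lambda>k. x ^ (k + m) * (1 - x) * (if m \<le> k + m then 1 else 0)) sums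
      (x ^ m - (\<Sum>k<m. x ^ k * (1 - x) * (if m \<le> k then 1 else 0)))"
    using assms by (simp add: power_add mult_ac)
  then show ?thesis by (rule sums_iff_shift'[THEN iffD1])
qed

text \<open>For \<open>q = p\<close> and \<open>a > n\<close> this is the sum, over \<open>u\<close>
  modulo \<O>^n, of the index of \<O>^n in \<open>\<O>^n + \<O>u\<close> raised to the power
  \<open>- a\<close>.\<close>

definition column_factor :: "real \<Rightarrow> real \<Rightarrow> real \<Rightarrow> real" where
  "column_factor q n a = (1 - q powr (- a)) / (1 - q powr (n - a))"

lemma nn_integral_adjoin_standard:
  assumes a: "a > real CARD('n::finite)"
  shows "(\<integral>\<^sup>+(u :: ('p::prime_card padic, 'n) vec).
      ennreal (enn2real (lat_index (adjoin integral_vectors u)) powr (- a)) \<partial>count_space vec_reps)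
    = ennreal (column_factor (real CARD('p)) (real CARD('n)) a)"
proof -
  let ?q = "real CARD('p)" and ?n = "CARD('n)"
  define x where "x = ?q powr (- a)"
  have q: "?q > 1" using card_prime_gt_1[where 'p='p] by simp
  have x: "0 < x" "x < 1" using q a by (auto simp: x_def powr_less_one)
  have xq: "x * ?q ^ ?n = ?q powr (real ?n - a)"
    using q by (simp add: x_def powr_diff powr_minus powr_realpow field_simps)
  \<comment> \<open>This is the ratio of the geometric series left after summation over
    \<open>u\<close>; \<open>a > n\<close> puts it below 1.\<close>
  have xq1: "x * ?q ^ ?n < 1" unfolding xq using q a by (intro powr_less_one) auto
  \<comment> \<open>Layer cake: if the index is \<open>q^m\<close>, its power is \<open>x^m\<close>, the sum of \<open>x^k (1 - x)\<close> over \<open>k \<ge> m\<close>,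
    and \<open>k \<ge> m\<close> means that \<open>u\<close> lies in \<open>p\<^bsup>-k\<^esup> \<O>\<^sup>n\<close>, a lattice of index \<open>q\<^bsup>nk\<^esup>\<close>.\<close>
  have "ennreal (enn2real (lat_index (adjoin integral_vectors u)) powr (- a)) =
      (\<Sum>k. ennreal (x ^ k * (1 - x)) * indicator {v. \<forall>i. padic_p ^ k * v $ i \<in> padic_integers} u)"
    for u :: "('p padic, 'n) vec"
  proof -
    obtain m where m: "lat_index (adjoin integral_vectors u) = ennreal (?q ^ m)"
      "\<And>k. padic_p ^ k *s u \<in> integral_vectors \<longleftrightarrow> m \<le> k"
      using adjoin_standard_lattice[of u] by blast
    have "(?q ^ m) powr (- a) = x ^ m"
      using q by (simp add: x_def powr_minus powr_realpow[symmetric] powr_powr mult.commute powr_power power_inverse)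
    then have "ennreal (enn2real (lat_index (adjoin integral_vectors u)) powr (- a)) = ennreal (x ^ m)"
      by (simp add: m(1))
    also have "\<dots> = (\<Sum>k. ennreal (x ^ k * (1 - x) * (if m \<le> k then 1 else 0)))"
      using x by (intro suminf_ennreal_eq[symmetric] geometric_tail_sums) auto
    also have "\<dots> = (\<Sum>k. ennreal (x ^ k * (1 - x)) * indicator {v. \<forall>i. padic_p ^ k * v $ i \<in> padic_integers} u)"
      using m(2) by (intro arg_cong[where f=suminf] ext) (auto simp: integral_vectors_def indicator_def)
    finally show ?thesis .
  qed
  then have "(\<integral>\<^sup>+(u :: ('p padic, 'n) vec).
      ennreal (enn2real (lat_index (adjoin integral_vectors u)) powr (- a)) \<partial>count_space vec_reps)
    = (\<integral>\<^sup>+(u :: ('p padic, 'n) vec). (\<Sum>k. ennreal (x ^ k * (1 - x)) * indicator {v. \<forall>i. padic_p ^ k * v $ i \<in> padic_integers} u) \<partial>count_space vec_reps)"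
    by simp
  also have "\<dots> = (\<Sum>k. \<integral>\<^sup>+(u :: ('p padic, 'n) vec). ennreal (x ^ k * (1 - x)) * indicator {v. \<forall>i. padic_p ^ k * v $ i \<in> padic_integers} u \<partial>count_space vec_reps)"
    by (rule nn_integral_suminf) simp
  also have "\<dots> = (\<Sum>k. ennreal (x ^ k * (1 - x)) * lat_index {v :: ('p padic, 'n) vec. \<forall>i. padic_p ^ k * v $ i \<in> padic_integers})"
    by (simp add: nn_integral_cmult lat_index_eq_nn_integral)
  also have "\<dots> = (\<Sum>k. ennreal ((1 - x) * (x * ?q ^ ?n) ^ k))"
  proof (intro arg_cong[where f=suminf] ext)
    fix k
    have "lat_index {v :: ('p padic, 'n) vec. \<forall>i. padic_p ^ k * v $ i \<in> padic_integers} = ennreal ((?q ^ ?n) ^ k)"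
      using lat_index_box[where 'p='p and k = "\<lambda>_::'n. k"] by (simp add: mult.commute flip: power_mult)
    then show "ennreal (x ^ k * (1 - x)) * lat_index {v :: ('p padic, 'n) vec. \<forall>i. padic_p ^ k * v $ i \<in> padic_integers}
        = ennreal ((1 - x) * (x * ?q ^ ?n) ^ k)"
      using x by (simp add: power_mult_distrib mult_ac flip: ennreal_mult)
  qed
  also have "\<dots> = ennreal ((1 - x) * (1 / (1 - x * ?q ^ ?n)))"
    using x xq1 by (intro suminf_ennreal_eq sums_mult geometric_sums) (auto simp: abs_mult)
  finally show ?thesis unfolding xq by (simp add: column_factor_def x_def)
qed

section \<open>Adjoining columns to general lattices\<close>

definition padic_lattice :: "('p::prime_card padic, 'n::finite) vec set \<Rightarrow> bool" where
  "padic_lattice L \<longleftrightarrow> (\<exists>g m. lin_bij g \<and> L = g ` integral_vectors \<and> integral_vectors \<subseteq> L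
     \<and> lat_index L = ennreal (real CARD('p) ^ m))"

lemma adjoin_image:
  assumes g: "lin_bij g"
  shows "adjoin (g ` L) (g u) = g ` adjoin L u"
  unfolding adjoin_def by (force simp: lin_bijD(1,2)[OF g])

lemma adjoin_add_closed:
  assumes "x \<in> adjoin integral_vectors u" "y \<in> integral_vectors"
  shows "x + y \<in> adjoin integral_vectors u"
proof -
  obtain l c where l: "l \<in> integral_vectors" "c \<in> padic_integers" "x = l + c *s u"
    using assms(1) by (auto simp: adjoin_def)
  then have "x + y = (l + y) + c *s u" by simp
  then show ?thesis unfolding adjoin_def using l integral_vectors_closed(2)[OF l(1) assms(2)] by blast
qed

lemma lat_index_adjoin_image:
  assumes g: "lin_bij g" and sub: "integral_vectors \<subseteq> g ` integral_vectors"
  shows "lat_index (adjoin (g ` integral_vectors) (g u)) =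
    lat_index (g ` integral_vectors) * lat_index (adjoin integral_vectors u)"
  unfolding adjoin_image[OF g] by (rule lat_index_image[OF g sub adjoin_add_closed])

lemma lattice_integral_vectors: "padic_lattice integral_vectors"
  unfolding padic_lattice_def
  by (rule exI[of _ "\<lambda>x. x"], rule exI[of _ 0]) (auto simp: lin_bij_def lat_index_integral_vectors bij_betw_def)

text \<open>Pull \<open>v\<close> back along \<open>g\<close> to \<open>u\<close>, adjoin
  \<open>u\<close> to \<O>^n and compose the two automorphisms. Indices multiply, so the exponents
  of \<open>p\<close> add.\<close>

lemma lattice_adjoin:
  assumes "padic_lattice L"
  shows "padic_lattice (adjoin L v)"
proof -
  obtain g m where g: "lin_bij g" "L = g ` integral_vectors" "integral_vectors \<subseteq> L"
     "lat_index L = ennreal (real CARD('a) ^ m)"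
    using assms by (auto simp: padic_lattice_def)
  obtain u where u: "v = g u" using surjD[OF bij_is_surj[OF lin_bijD(5)[OF g(1)]]] by blast
  obtain g' m' where g': "lin_bij g'" "adjoin integral_vectors u = g' ` integral_vectors"
    "lat_index (adjoin integral_vectors u) = ennreal (real CARD('a) ^ m')"
    using adjoin_standard_lattice[of u] by blast
  have "lat_index (adjoin L v) = ennreal (real CARD('a) ^ (m + m'))"
    using lat_index_adjoin_image[OF g(1), of u] g g'(3)
    by (simp add: u power_add ennreal_mult)
  moreover have "adjoin L v = (g \<circ> g') ` integral_vectors"
    by (simp add: g(2) u adjoin_image[OF g(1)] g'(2) image_comp)
  ultimately show ?thesis
    unfolding padic_lattice_def using lin_bij_comp[OF g(1) g'(1)] g(3) subset_adjoin[of L v] by blast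
qed

text \<open>For \<open>v = g u\<close> the index of \<open>adjoin L v\<close> is that of
  \<open>L\<close> times that of \<open>adjoin integral_vectors u\<close>, contributing the power
  \<open>- a\<close> of the index of \<open>L\<close>. Splitting classes modulo \<open>L\<close>
  into classes modulo \<O>^n contributes one more factor, hence the exponent
  \<open>- (a - 1)\<close>. Finiteness of the index of \<open>L\<close> makes the real powers
  multiply.\<close>

lemma nn_integral_adjoin:
  fixes L :: "('p::prime_card padic, 'n::finite) vec set"
  assumes L: "padic_lattice L" and a: "a > real CARD('n)"
  shows "(\<integral>\<^sup>+v. ennreal (enn2real (lat_index (adjoin L v)) powr (- a)) \<partial>count_space vec_reps)
    = ennreal (enn2real (lat_index L) powr (- (a - 1))) *
      ennreal (column_factor (real CARD('p)) (real CARD('n)) a)"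
proof -
  obtain g m where g: "lin_bij g" "L = g ` integral_vectors" "integral_vectors \<subseteq> L"
     "lat_index L = ennreal (real CARD('p) ^ m)"
    using L by (auto simp: padic_lattice_def)
  let ?r = "real CARD('p) ^ m"
  have r: "?r > 0" by simp
  have closed: "x + y \<in> L" if "x \<in> L" "y \<in> L" for x y
    using that unfolding g(2) by (force simp: lin_bijD(1)[OF g(1), symmetric] intro: integral_vectors_closed)
  have neg: "- y \<in> L" if y: "y \<in> L" for y
  proof -
    obtain w where w: "w \<in> integral_vectors" "y = g w" using y g(2) by blast
    have "- y = g (- w)" using lin_bijD(3)[OF g(1), of 0 w] lin_bijD(4)[OF g(1)] w(2) by simp
    with w(1) show ?thesis unfolding g(2) using integral_vectors_closed(4) by blast
  qed
  have adj: "adjoin L (v + l) \<subseteq> adjoin L v" if l: "l \<in> L" for v l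
  proof
    fix x assume "x \<in> adjoin L (v + l)"
    then obtain y c where y: "y \<in> L" "c \<in> padic_integers" "x = y + c *s (v + l)" by (auto simp: adjoin_def)
    obtain w where w: "w \<in> integral_vectors" "l = g w" using l g(2) by blast
    have "c *s l \<in> L" unfolding w(2) g(2) lin_bijD(2)[OF g(1), symmetric]
      using integral_vectors_closed(5)[OF y(2) w(1)] by blast
    moreover have "x = (y + c *s l) + c *s v" by (simp add: y(3) vector_add_ldistrib)
    ultimately show "x \<in> adjoin L v" unfolding adjoin_def using y closed by blast
  qed
  \<comment> \<open>The inclusion is applied to \<open>l\<close> and to \<open>- l\<close>. This is
    the periodicity that \<open>nn_integral_reps_sublattice\<close> asks for.\<close>
  have per: "adjoin L (v + l) = adjoin L v" if l: "l \<in> L" for v l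
    using adj[OF l, of v] adj[OF neg[OF l], of "v + l"] by simp
  have "(\<integral>\<^sup>+v. ennreal (enn2real (lat_index (adjoin L v)) powr (- a)) \<partial>count_space vec_reps)
    = lat_index L * (\<integral>\<^sup>+u. ennreal (enn2real (lat_index (adjoin L (g u))) powr (- a)) \<partial>count_space vec_reps)"
    unfolding g(2) by (rule nn_integral_reps_sublattice[OF g(1)]) (use g per in simp_all)
  also have "\<dots> = lat_index L * (\<integral>\<^sup>+(u :: ('p padic, 'n) vec). ennreal (?r powr (- a)) *
      ennreal (enn2real (lat_index (adjoin integral_vectors u)) powr (- a)) \<partial>count_space vec_reps)"
    using g lat_index_adjoin_image[OF g(1)] r
    by (simp add: enn2real_mult powr_mult ennreal_mult)
  also have "\<dots> = lat_index L * ennreal (?r powr (- a)) * ennreal (column_factor (real CARD('p)) (real CARD('n)) a)"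
    by (simp add: nn_integral_cmult nn_integral_adjoin_standard[OF a] mult.assoc)
  also have "lat_index L * ennreal (?r powr (- a)) = ennreal (?r powr (- (a - 1)))"
    using r by (simp add: g(4) ennreal_mult[symmetric] powr_diff powr_minus field_simps)
  finally show ?thesis by (simp add: g(4))
qed

definition generated_lattice :: "'j set \<Rightarrow> ('j \<Rightarrow> ('p::prime_card padic, 'n::finite) vec) \<Rightarrow> ('p padic, 'n) vec set" where
  "generated_lattice J w = {x + (\<Sum>j\<in>J. c j *s w j) | x c. x \<in> integral_vectors \<and> (\<forall>j. c j \<in> padic_integers)}"

lemma generated_lattice_empty: "generated_lattice {} w = integral_vectors"
  using padic_integers_closed(1) by (auto simp: generated_lattice_def)

text \<open>The update \<open>w(j := v)\<close> is the form in which a family on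
  \<open>insert j J\<close> splits into a value at \<open>j\<close> and a family on
  \<open>J\<close>.\<close>

lemma generated_lattice_insert:
  assumes "finite J" "j \<notin> J"
  shows "generated_lattice (insert j J) (w(j := v)) = adjoin (generated_lattice J w) v"
proof -
  have eq: "(\<Sum>i\<in>J. c i *s (if i = j then v else w i)) = (\<Sum>i\<in>J. c i *s w i)" for c
    using assms by (intro sum.cong) auto
  show ?thesis
  proof (intro equalityI subsetI)
    fix y assume "y \<in> generated_lattice (insert j J) (w(j := v))"
    then obtain x c where x: "x \<in> integral_vectors" "\<And>j. c j \<in> padic_integers"
        "y = x + (\<Sum>i\<in>insert j J. c i *s (w(j := v)) i)"
      by (auto simp: generated_lattice_def)
    then have "y = (x + (\<Sum>i\<in>J. c i *s w i)) + c j *s v" using assms by (simp add: eq add_ac)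
    with x show "y \<in> adjoin (generated_lattice J w) v"
      unfolding adjoin_def generated_lattice_def by blast
  next
    fix y assume "y \<in> adjoin (generated_lattice J w) v"
    then obtain x c d where x: "x \<in> integral_vectors" "\<And>j. c j \<in> padic_integers" "d \<in> padic_integers"
        "y = (x + (\<Sum>i\<in>J. c i *s w i)) + d *s v"
      by (auto simp: generated_lattice_def adjoin_def)
    have "(\<Sum>i\<in>J. (c(j := d)) i *s (w(j := v)) i) = (\<Sum>i\<in>J. c i *s w i)"
      using assms by (intro sum.cong) auto
    then have "y = x + (\<Sum>i\<in>insert j J. (c(j := d)) i *s (w(j := v)) i)"
      using assms by (simp add: x(4) add_ac del: fun_upd_apply) (simp add: add_ac)
    moreover have "\<forall>i. (c(j := d)) i \<in> padic_integers" using x by simp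
    ultimately show "y \<in> generated_lattice (insert j J) (w(j := v))"
      unfolding generated_lattice_def using x(1) by blast
  qed
qed

lemma lattice_generated: "finite J \<Longrightarrow> padic_lattice (generated_lattice J w)"
proof (induction J rule: finite_induct)
  case (insert j J)
  then show ?case
    using generated_lattice_insert[of J j w "w j"] by (simp add: lattice_adjoin)
qed (simp add: generated_lattice_empty lattice_integral_vectors)

text \<open>Summing over the new column innermost leaves the same sum over fewer columns with
  exponent \<open>a - 1\<close>, so the induction varies \<open>a\<close>. The bound on
  \<open>a\<close> keeps even the smallest exponent \<open>a - card J + 1\<close> above
  \<open>n\<close>.\<close>

lemma nn_integral_generated_lattice:
  assumes "finite J" "a > real CARD('n) + real (card J) - 1"
  shows "(\<integral>\<^sup>+w. ennreal (enn2real (lat_index (generated_lattice J w)) powr (- a))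
      \<partial>count_space (PiE J (\<lambda>_. vec_reps :: ('p::prime_card padic, 'n::finite) vec set)))
    = (\<Prod>i<card J. ennreal (column_factor (real CARD('p)) (real CARD('n)) (a - real i)))"
  using assms
proof (induction J arbitrary: a rule: finite_induct)
  case empty
  show ?case
    by (simp add: generated_lattice_empty lat_index_integral_vectors nn_integral_count_space_finite)
next
  case (insert j J)
  let ?V = "vec_reps :: ('p padic, 'n) vec set"
  have a: "a > real CARD('n) + real (card J)" using insert by simp
  have "bij_betw (\<lambda>(y, w). w(j := y)) (?V \<times> PiE J (\<lambda>_. ?V)) (PiE (insert j J) (\<lambda>_. ?V))"
    unfolding bij_betw_def PiE_insert_eq using inj_combinator[OF insert(2), of "\<lambda>_. ?V"] by simp
  then have "(\<integral>\<^sup>+w. ennreal (enn2real (lat_index (generated_lattice (insert j J) w)) powr (- a))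
      \<partial>count_space (PiE (insert j J) (\<lambda>_. ?V)))
    = (\<integral>\<^sup>+z. ennreal (enn2real (lat_index (generated_lattice (insert j J) ((\<lambda>(y, w). w(j := y)) z))) powr (- a))
      \<partial>count_space (?V \<times> PiE J (\<lambda>_. ?V)))"
    by (rule nn_integral_bij_count_space[symmetric])
  also have "\<dots> = (\<integral>\<^sup>+w. \<integral>\<^sup>+v. ennreal (enn2real (lat_index (adjoin (generated_lattice J w) v)) powr (- a))
      \<partial>count_space ?V \<partial>count_space (PiE J (\<lambda>_. ?V)))"
    by (subst nn_integral_count_space_Times) (simp add: generated_lattice_insert[OF insert(1,2)])
  also have "\<dots> = (\<integral>\<^sup>+w. ennreal (enn2real (lat_index (generated_lattice J w)) powr (- (a - 1)))
      * ennreal (column_factor (real CARD('p)) (real CARD('n)) a) \<partial>count_space (PiE J (\<lambda>_. ?V)))"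
    using a by (intro nn_integral_cong nn_integral_adjoin lattice_generated insert(1)) simp
  also have "\<dots> = (\<Prod>i<card J. ennreal (column_factor (real CARD('p)) (real CARD('n)) (a - 1 - real i)))
      * ennreal (column_factor (real CARD('p)) (real CARD('n)) a)"
    using a insert(3)[of "a - 1"] by (simp add: nn_integral_multc)
  \<comment> \<open>The new factor becomes the term \<open>i = 0\<close>, and the factors from the
    induction hypothesis move up by one.\<close>
  also have "\<dots> = (\<Prod>i<card (insert j J). ennreal (column_factor (real CARD('p)) (real CARD('n)) (a - real i)))"
    using insert(1,2) by (simp add: prod.lessThan_Suc_shift mult.commute diff_diff_eq add.commute del: prod.lessThan_Suc)
  finally show ?case .
qed

section \<open>Diagonalization over the \<open>p\<close>-adic integers\<close>

lemma integral_matrices_mult: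
  "A \<in> integral_matrices \<Longrightarrow> B \<in> integral_matrices \<Longrightarrow> A ** B \<in> integral_matrices"
  by (auto simp: integral_matrices_def matrix_matrix_mult_def intro!: padic_integers_sum padic_integers_closed)

lemma integral_GL_mult:
  assumes "A \<in> integral_GL" "B \<in> integral_GL"
  shows "A ** B \<in> integral_GL"
proof -
  obtain A' B' where A: "A \<in> integral_matrices" "A' \<in> integral_matrices" "A ** A' = mat 1" "A' ** A = mat 1"
    and B: "B \<in> integral_matrices" "B' \<in> integral_matrices" "B ** B' = mat 1" "B' ** B = mat 1"
    using assms by (auto simp: integral_GL_def)
  have "(A ** B) ** (B' ** A') = mat 1" "(B' ** A') ** (A ** B) = mat 1"
    by (metis A(3) B(3) matrix_mul_assoc matrix_mul_rid, metis A(4) B(4) matrix_mul_assoc matrix_mul_rid)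
  then show ?thesis
    using A B by (auto simp: integral_GL_def intro: integral_matrices_mult)
qed

lemma mat_1_integral_GL: "mat 1 \<in> integral_GL"
  by (auto simp: integral_GL_def integral_matrices_def mat_def padic_integers_closed intro!: exI[of _ "mat 1"])
    (auto simp: matrix_mul_lid mat_def[symmetric])

definition gl_equiv :: "('p::prime_card, 'n::finite) padic_matrix \<Rightarrow> ('p, 'n) padic_matrix \<Rightarrow> bool" where
  "gl_equiv z z' \<longleftrightarrow> (\<exists>A\<in>integral_GL. \<exists>B\<in>integral_GL. z = A ** z' ** B)"

lemma gl_equiv_refl: "gl_equiv z z"
  unfolding gl_equiv_def using mat_1_integral_GL by (metis matrix_mul_lid matrix_mul_rid)

lemma gl_equiv_trans:
  assumes "gl_equiv x y" "gl_equiv y z"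
  shows "gl_equiv x z"
proof -
  obtain A B C D where *: "A \<in> integral_GL" "B \<in> integral_GL" "x = A ** y ** B"
    "C \<in> integral_GL" "D \<in> integral_GL" "y = C ** z ** D"
    using assms by (auto simp: gl_equiv_def)
  then have "x = (A ** C) ** z ** (D ** B)" by (simp add: matrix_mul_assoc)
  with * show ?thesis unfolding gl_equiv_def by (blast intro: integral_GL_mult)
qed

lemma gl_equiv_left_mult:
  assumes "A \<in> integral_matrices" "A' \<in> integral_matrices" "A' ** A = mat 1" "A ** A' = mat 1"
  shows "gl_equiv z (A ** z)"
proof -
  have "A' \<in> integral_GL" using assms by (auto simp: integral_GL_def)
  moreover have "z = A' ** (A ** z) ** mat 1" by (simp add: matrix_mul_assoc assms(3))
  ultimately show ?thesis unfolding gl_equiv_def using mat_1_integral_GL by blast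
qed

lemma gl_equiv_right_mult:
  assumes "A \<in> integral_matrices" "A' \<in> integral_matrices" "A' ** A = mat 1" "A ** A' = mat 1"
  shows "gl_equiv z (z ** A)"
proof -
  have "A' \<in> integral_GL" using assms by (auto simp: integral_GL_def)
  moreover have "z = mat 1 ** (z ** A) ** A'" by (simp add: matrix_mul_assoc[symmetric] assms(4))
  ultimately show ?thesis unfolding gl_equiv_def using mat_1_integral_GL by blast
qed

text \<open>Exchanging two rows and two columns is multiplication by transposition matrices, which
  are integral and their own inverses.\<close>

lemma gl_equiv_swap:
  fixes z :: "('p::prime_card, 'n::finite) padic_matrix"
  shows "gl_equiv z (\<chi> i j. z $ Transposition.transpose a b i $ Transposition.transpose c d j)"
proof -
  define T where "T a b = (\<chi> i j. if j = Transposition.transpose a b i then (1 :: 'p padic) else 0)" for a b :: 'n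
  have T_left: "T a b ** z = (\<chi> i. z $ Transposition.transpose a b i)" for a b and z :: "('p, 'n) padic_matrix"
    by (simp add: T_def matrix_matrix_mult_def vec_eq_iff if_distribR if_distrib[of "\<lambda>x. x * _"] cong: if_cong)
  have T_right: "z ** T a b = (\<chi> i j. z $ i $ Transposition.transpose a b j)" for a b and z :: "('p, 'n) padic_matrix"
  proof -
    have iff: "j = Transposition.transpose a b k \<longleftrightarrow> k = Transposition.transpose a b j" for j k
      by (metis transpose_involutory)
    have "(\<Sum>k\<in>UNIV. if j = Transposition.transpose a b k then f k else 0) = f (Transposition.transpose a b j)"
      for f :: "'n \<Rightarrow> 'p padic" and j
      by (simp only: iff[of j]) simp
    then show ?thesis
      by (simp add: T_def matrix_matrix_mult_def vec_eq_iff if_distrib[of "\<lambda>x. _ * x"] cong: if_cong)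
  qed
  have T_T: "T a b ** T a b = mat 1" for a b
    unfolding T_left by (auto simp: T_def mat_def vec_eq_iff)
  have T_int: "T a b \<in> integral_matrices" for a b
    by (simp add: T_def integral_matrices_def padic_integers_closed)
  have "gl_equiv z (T a b ** z)" by (intro gl_equiv_left_mult[OF T_int[of a b] T_int[of a b]] T_T)
  moreover have "gl_equiv (T a b ** z) (T a b ** z ** T c d)" by (intro gl_equiv_right_mult[OF T_int[of c d] T_int[of c d]] T_T)
  moreover have "T a b ** z ** T c d = (\<chi> i j. z $ Transposition.transpose a b i $ Transposition.transpose c d j)"
    by (simp add: T_left T_right)
  ultimately show ?thesis using gl_equiv_trans by metis
qed

text \<open>Every row \<open>i\<close> receives \<open>c i\<close> times row \<open>b\<close>, and
  row \<open>b\<close> itself is scaled by the unit \<open>1 + c b\<close>. One operation thus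
  clears a column and normalizes its pivot.\<close>

lemma gl_equiv_row_op:
  fixes z :: "('p::prime_card, 'n::finite) padic_matrix"
  assumes c: "\<And>i. c i \<in> padic_integers" and unit: "inverse (1 + c b) \<in> padic_integers" "1 + c b \<noteq> 0"
  shows "gl_equiv z (\<chi> i j. z $ i $ j + c i * z $ b $ j)"
proof -
  define E where "E c = (\<chi> i j. (if j = i then 1 else 0) + (if j = b then c i else 0 :: 'p padic))" for c
  have E_mult: "E c ** z = (\<chi> i j. z $ i $ j + c i * z $ b $ j)" for c and z :: "('p, 'n) padic_matrix"
    by (simp add: E_def matrix_matrix_mult_def vec_eq_iff distrib_right sum.distrib
      if_distrib[of "\<lambda>x. x * _"] cong: if_cong)
  have E_int: "E c \<in> integral_matrices" if "\<And>i. c i \<in> padic_integers" for c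
    using that by (auto simp: E_def integral_matrices_def intro!: padic_integers_closed)
  \<comment> \<open>Composing the operations with multipliers \<open>c\<close> and \<open>d\<close>
    gives multipliers \<open>d i + c i * (1 + d b)\<close>; \<open>?c'\<close> makes these vanish in
    both orders.\<close>
  let ?c' = "\<lambda>i. - c i * inverse (1 + c b)"
  have E_E: "E c ** E d = mat 1" if "\<And>i. d i + c i * (1 + d b) = 0" for c d
  proof -
    have "(E c ** E d) $ i $ j = mat 1 $ i $ j" for i j
      using that[of i] unfolding E_mult by (cases "j = b") (auto simp: E_def mat_def add.assoc)
    then show ?thesis by (simp add: vec_eq_iff)
  qed
  have "1 + ?c' b = inverse (1 + c b)" using unit(2) by (simp add: field_simps)
  then have "E c ** E ?c' = mat 1" "E ?c' ** E c = mat 1"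
    using unit(2) by (auto intro!: E_E)
  moreover have "?c' i \<in> padic_integers" for i
    using c unit by (intro padic_integers_closed(6,7))
  ultimately have "gl_equiv z (E c ** z)" by (intro gl_equiv_left_mult[of "E c" "E ?c'"] E_int c)
  then show ?thesis by (simp add: E_mult)
qed

lemma gl_equiv_column_op:
  fixes z :: "('p::prime_card, 'n::finite) padic_matrix"
  assumes c: "\<And>j. c j \<in> padic_integers" and b: "c b = 0"
  shows "gl_equiv z (\<chi> i j. z $ i $ j + z $ i $ b * c j)"
proof -
  define E where "E c = (\<chi> i j. (if i = j then 1 else 0) + (if i = b then c j else 0 :: 'p padic))" for c
  have E_mult: "z ** E c = (\<chi> i j. z $ i $ j + z $ i $ b * c j)" for c and z :: "('p, 'n) padic_matrix"
    by (simp add: E_def matrix_matrix_mult_def vec_eq_iff distrib_left sum.distrib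
      if_distrib[of "\<lambda>x. _ * x"] cong: if_cong)
  have E_int: "E c \<in> integral_matrices" if "\<And>i. c i \<in> padic_integers" for c
    using that by (auto simp: E_def integral_matrices_def intro!: padic_integers_closed)
  let ?c' = "\<lambda>i. - c i"
  have "E c ** E ?c' = mat 1" "E ?c' ** E c = mat 1"
    unfolding E_mult using b by (auto simp: E_def mat_def vec_eq_iff)
  moreover have "?c' i \<in> padic_integers" for i
    using c by (intro padic_integers_closed(6))
  ultimately have "gl_equiv z (z ** E c)" by (intro gl_equiv_right_mult[of "E c" "E ?c'"] E_int c)
  then show ?thesis by (simp add: E_mult)
qed

section \<open>Divisibility over \<O> and elimination with pivots\<close>

definition pdvd :: "'p::prime_card padic \<Rightarrow> 'p padic \<Rightarrow> bool" where
  "pdvd x a \<longleftrightarrow> (\<exists>c\<in>padic_integers. a = c * x)"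

lemma pdvd_add: "pdvd x a \<Longrightarrow> pdvd x b \<Longrightarrow> pdvd x (a + b)"
  unfolding pdvd_def by (metis distrib_right padic_integers_closed(4))

lemma pdvd_mult: "pdvd x a \<Longrightarrow> c \<in> padic_integers \<Longrightarrow> pdvd x (c * a)"
  unfolding pdvd_def by (metis mult.assoc padic_integers_closed(7))

lemma pdvd_trans: "pdvd x y \<Longrightarrow> pdvd y a \<Longrightarrow> pdvd x a"
  unfolding pdvd_def by (metis mult.assoc padic_integers_closed(7))

lemma pdvd_quotient: "pdvd x a \<Longrightarrow> x \<noteq> 0 \<Longrightarrow> a / x \<in> padic_integers"
  by (auto simp: pdvd_def)

text \<open>A larger exponent means a smaller valuation, so divisibility reverses the order. The
  entry 0 at \<open>Minf\<close> divides only itself.\<close>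

lemma pdvd_p_neg_power:
  assumes "pdvd (p_neg_power k :: 'p::prime_card padic) (p_neg_power l)" "k \<noteq> Pinf" "l \<noteq> Pinf"
  shows "l \<le> k"
proof (cases k)
  case (Fin a)
  show ?thesis
  proof (cases l)
    case (Fin b)
    obtain c :: "'p padic" where c: "c \<in> padic_integers" "padic_p powi (- b) = c * padic_p powi (- a)"
      using assms(1) by (auto simp: pdvd_def \<open>k = Fin a\<close> Fin)
    have "padic_p powi (a - b) = padic_p powi a * (padic_p powi (- b) :: 'p padic)"
      by (simp add: power_int_add[symmetric])
    also have "\<dots> = c" unfolding c(2) by (simp add: power_int_minus)
    finally have "0 \<le> a - b" using c(1) padic_p_powi_integral_iff by metis
    then show ?thesis by (simp add: \<open>k = Fin a\<close> Fin)
  qed (use assms in simp_all)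
next
  case Minf
  then have "p_neg_power l = (0 :: 'p padic)" using assms(1) by (simp add: pdvd_def)
  then show ?thesis using Minf assms(3) by (cases l) simp_all
qed (use assms in simp)

text \<open>The entries outside \<open>S\<close> are multiples of the pivots in \<open>S\<close>; choosing at each step a pivot that
  divides all remaining entries makes the exponents decrease.\<close>

definition partially_diagonal ::
  "'n set \<Rightarrow> ('p::prime_card, 'n::{finite,linorder}) padic_matrix \<Rightarrow> ('n \<Rightarrow> int extended) \<Rightarrow> bool" where
  "partially_diagonal S z k \<longleftrightarrow>
     (\<forall>i j. i \<noteq> j \<longrightarrow> i \<in> S \<or> j \<in> S \<longrightarrow> z $ i $ j = 0) \<and>
     (\<forall>i\<in>S. z $ i $ i = p_neg_power (k i)) \<and> (\<forall>i\<in>S. k i \<noteq> Pinf) \<and>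
     (\<forall>i\<in>S. \<forall>r c. r \<notin> S \<longrightarrow> c \<notin> S \<longrightarrow> pdvd (z $ i $ i) (z $ r $ c)) \<and>
     (\<forall>i\<in>S. \<forall>j\<in>S. i \<le> j \<longrightarrow> k j \<le> k i)"

text \<open>Gaussian elimination in increasing order of the index: a dominating entry of the
  remaining block is moved to position \<open>(b, b)\<close>, turned into a pure power of
  \<open>p\<close>, and used to clear its column and then its row.\<close>

lemma partial_diagonalization:
  fixes z :: "('p::prime_card, 'n::{finite,linorder}) padic_matrix"
  shows "\<exists>z' k. gl_equiv z z' \<and> partially_diagonal S z' k"
  using finite[of S]
proof (induction S rule: finite_linorder_max_induct)
  case empty
  show ?case using gl_equiv_refl[of z] by (auto simp: partially_diagonal_def)
next
  case (insert b S)
  obtain z' k where eq': "gl_equiv z z'" and pd: "partially_diagonal S z' k"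
    using insert(3) by blast
  note pd' = pd[unfolded partially_diagonal_def]
  have off': "\<And>i j. i \<noteq> j \<Longrightarrow> i \<in> S \<or> j \<in> S \<Longrightarrow> z' $ i $ j = 0"
    using pd'[THEN conjunct1] by blast
  have diag': "\<And>i. i \<in> S \<Longrightarrow> z' $ i $ i = p_neg_power (k i)"
    using pd'[THEN conjunct2, THEN conjunct1] by blast
  have Pinf: "\<And>i. i \<in> S \<Longrightarrow> k i \<noteq> Pinf"
    using pd'[THEN conjunct2, THEN conjunct2, THEN conjunct1] by blast
  have dvd': "\<And>i r c. i \<in> S \<Longrightarrow> r \<notin> S \<Longrightarrow> c \<notin> S \<Longrightarrow> pdvd (z' $ i $ i) (z' $ r $ c)"
    using pd'[THEN conjunct2, THEN conjunct2, THEN conjunct2, THEN conjunct1] by blast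
  have mono: "\<And>i j. i \<in> S \<Longrightarrow> j \<in> S \<Longrightarrow> i \<le> j \<Longrightarrow> k j \<le> k i"
    using pd'[THEN conjunct2, THEN conjunct2, THEN conjunct2, THEN conjunct2] by blast
  have bS: "b \<notin> S" using insert(2) by auto
  obtain r c where rc: "r \<notin> S" "c \<notin> S" and max': "\<And>i j. i \<notin> S \<Longrightarrow> j \<notin> S \<Longrightarrow> pdvd (z' $ r $ c) (z' $ i $ j)"
  proof -
    have "finite ((\<lambda>(i, j). z' $ i $ j) ` ((- S) \<times> (- S)))" "(\<lambda>(i, j). z' $ i $ j) ` ((- S) \<times> (- S)) \<noteq> {}"
      using bS by auto
    from ex_dominating_element[OF this] show ?thesis
      using that by (auto simp: pdvd_def)
  qed
  \<comment> \<open>As \<open>b\<close>, \<open>r\<close> and \<open>c\<close> lie outside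
    \<open>S\<close>, both transpositions fix \<open>S\<close> pointwise and leave the finished
    pivots in place.\<close>
  let ?r = "Transposition.transpose b r" and ?c = "Transposition.transpose b c"
  define z1 where "z1 = (\<chi> i j. z' $ ?r i $ ?c j)"
  have eq1: "gl_equiv z z1" unfolding z1_def by (rule gl_equiv_trans[OF eq' gl_equiv_swap])
  have r_out: "?r i \<notin> S \<longleftrightarrow> i \<notin> S" and c_out: "?c i \<notin> S \<longleftrightarrow> i \<notin> S" for i
    using bS rc by (auto simp: transpose_eq_iff Transposition.transpose_def)
  have r_in: "?r i = i" and c_in: "?c i = i" if "i \<in> S" for i
    using that bS rc by (auto simp: Transposition.transpose_def)
  have off1: "z1 $ i $ j = 0" if "i \<noteq> j" "i \<in> S \<or> j \<in> S" for i j
    using that r_out[of i] c_out[of j] by (auto simp: z1_def r_in c_in intro!: off')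
  have diag1: "z1 $ i $ i = z' $ i $ i" if "i \<in> S" for i
    using that by (simp add: z1_def r_in c_in)
  have dvd1: "pdvd (z' $ i $ i) (z1 $ s $ t)" if "i \<in> S" "s \<notin> S" "t \<notin> S" for i s t
    using that by (simp add: z1_def dvd' r_out c_out)
  define v where "v = z1 $ b $ b"
  have max1: "pdvd v (z1 $ i $ j)" if "i \<notin> S" "j \<notin> S" for i j
    using that by (simp add: v_def z1_def max' r_out c_out)
  show ?case
  proof (cases "v = 0")
    case True
    \<comment> \<open>A dominating entry 0 forces the whole remaining block to vanish, so the
      exponent is \<open>Minf\<close>.\<close>
    then have 0: "z1 $ i $ j = 0" if "i \<notin> S" "j \<notin> S" for i j
      using max1[OF that] by (simp add: pdvd_def)
    show ?thesis
    unfolding partially_diagonal_def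
    proof (intro exI[of _ z1] exI[of _ "k(b := Minf)"] conjI allI ballI impI)
      show "gl_equiv z z1" by (rule eq1)
      show "z1 $ i $ j = 0" if "i \<noteq> j" "i \<in> insert b S \<or> j \<in> insert b S" for i j
        using that off1 0 by blast
      show "z1 $ i $ i = p_neg_power ((k(b := Minf)) i)" "(k(b := Minf)) i \<noteq> Pinf" if "i \<in> insert b S" for i
        using that bS diag1 diag' Pinf 0 by auto
      show "pdvd (z1 $ i $ i) (z1 $ s $ t)" if "i \<in> insert b S" "s \<notin> insert b S" "t \<notin> insert b S" for i s t
        using that 0[of s t] padic_integers_closed(1) by (auto simp: pdvd_def)
      show "(k(b := Minf)) j \<le> (k(b := Minf)) i" if "i \<in> insert b S" "j \<in> insert b S" "i \<le> j" for i j
        using that mono insert(2) bS by force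
    qed
  next
    case False
    obtain e w where w: "v = padic_p powi e * w" "w \<in> padic_integers" "inverse w \<in> padic_integers"
      using padic_factor[OF False] .
    have w0: "w \<noteq> 0" using False w(1) by auto
    \<comment> \<open>The multiplier at \<open>b\<close> scales the pivot row by
      \<open>inverse w\<close>, so that the pivot becomes \<open>padic_p powi e\<close>; the other
      multipliers clear column \<open>b\<close>.\<close>
    define c where "c i = (if i \<in> S then 0 else if i = b then inverse w - 1 else - (z1 $ i $ b / v))" for i
    have c_int: "c i \<in> padic_integers" for i
      using w(3) pdvd_quotient[OF max1 False] bS
      by (auto simp: c_def intro!: padic_integers_closed(1,2,5,6))
    define z2 where "z2 = (\<chi> i j. z1 $ i $ j + c i * z1 $ b $ j)"
    have "gl_equiv z1 z2"
      unfolding z2_def by (rule gl_equiv_row_op) (use c_int w w0 bS in \<open>auto simp: c_def\<close>)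
    then have eq2: "gl_equiv z z2" by (rule gl_equiv_trans[OF eq1])
    have z2_b: "z2 $ b $ j = inverse w * z1 $ b $ j" for j
      using bS by (simp add: z2_def c_def algebra_simps)
    have bb: "z2 $ b $ b = padic_p powi e"
      using w0 by (simp add: z2_b v_def[symmetric] w(1))
    have dvd2: "pdvd x (z2 $ s $ t)" if "\<And>s t. s \<notin> S \<Longrightarrow> t \<notin> S \<Longrightarrow> pdvd x (z1 $ s $ t)" "s \<notin> S" "t \<notin> S" for x s t
      using that bS c_int by (simp add: z2_def pdvd_add pdvd_mult)
    have v_bb: "pdvd (z2 $ b $ b) v"
      using w bb by (auto simp: pdvd_def mult.commute)
    have max2: "pdvd (z2 $ b $ b) (z2 $ s $ t)" if "s \<notin> S" "t \<notin> S" for s t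
      by (rule dvd2) (use that max1 pdvd_trans[OF v_bb] in auto)
    have off2: "z2 $ i $ j = 0" if "i \<noteq> j" "i \<in> S \<or> j \<in> S" for i j
      using that bS off1[of i j] off1[of b j] by (auto simp: z2_def c_def)
    have b2: "z2 $ i $ b = 0" if "i \<noteq> b" for i
      using that bS off1[of i b] False by (auto simp: z2_def c_def v_def)
    \<comment> \<open>Column \<open>b\<close> now contains only the pivot, so subtracting its
      multiples changes row \<open>b\<close> alone and clears it.\<close>
    define d where "d j = (if j \<in> insert b S then 0 else - (z2 $ b $ j / z2 $ b $ b))" for j
    have d_int: "d j \<in> padic_integers" for j
      using pdvd_quotient[OF max2, of b j] bS bb
      by (auto simp: d_def intro!: padic_integers_closed(1,6))
    define z3 where "z3 = (\<chi> i j. z2 $ i $ j + z2 $ i $ b * d j)"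
    have "gl_equiv z2 z3"
      unfolding z3_def by (rule gl_equiv_column_op) (use d_int in \<open>auto simp: d_def\<close>)
    then have eq3: "gl_equiv z z3" by (rule gl_equiv_trans[OF eq2])
    have bb3: "z3 $ b $ b = z2 $ b $ b" by (simp add: z3_def d_def)
    have ii3: "z3 $ i $ i = z' $ i $ i" if "i \<in> S" for i
      using that diag1[OF that] bS by (auto simp: z3_def z2_def c_def d_def)
    have out3: "z3 $ s $ t = z2 $ s $ t" if "s \<noteq> b" for s t
      using b2[OF that] by (simp add: z3_def)
    let ?k = "k(b := Fin (- e))"
    \<comment> \<open>Earlier pivots divide the new one, so their exponents are at least as large.
      The sign in \<open>Fin (- e)\<close> comes from \<open>p_neg_power\<close>.\<close>
    have kb: "Fin (- e) \<le> k i" if "i \<in> S" for i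
    proof -
      have "pdvd (z' $ i $ i) (z2 $ b $ b)" by (rule dvd2) (use that dvd1 bS in auto)
      then have "pdvd (p_neg_power (k i) :: 'p padic) (p_neg_power (Fin (- e)))"
        using diag'[OF that] bb by simp
      then show ?thesis using pdvd_p_neg_power Pinf[OF that] by blast
    qed
    show ?thesis
    unfolding partially_diagonal_def
    proof (intro exI[of _ z3] exI[of _ ?k] conjI allI ballI impI)
      show "gl_equiv z z3" by (rule eq3)
      show "z3 $ i $ j = 0" if "i \<noteq> j" "i \<in> insert b S \<or> j \<in> insert b S" for i j
      proof (cases "i = b")
        case True
        then show ?thesis
          using that bb off2[of b j] by (cases "j \<in> S") (auto simp: z3_def d_def)
      next
        case False
        then show ?thesis using that b2 off2[of i j] by (auto simp: out3)
      qed
      show "z3 $ i $ i = p_neg_power (?k i)" "?k i \<noteq> Pinf" if "i \<in> insert b S" for i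
        using that bS ii3 diag' bb3 bb Pinf by auto
      show "pdvd (z3 $ i $ i) (z3 $ s $ t)" if "i \<in> insert b S" "s \<notin> insert b S" "t \<notin> insert b S" for i s t
      proof (cases "i = b")
        case True
        then show ?thesis using that max2[of s t] by (simp add: bb3 out3)
      next
        case False
        then have "pdvd (z' $ i $ i) (z2 $ s $ t)" by (intro dvd2) (use that dvd1 in auto)
        then show ?thesis using that False by (simp add: ii3 out3)
      qed
      show "?k j \<le> ?k i" if "i \<in> insert b S" "j \<in> insert b S" "i \<le> j" for i j
        using that mono insert(2) bS kb by force
    qed
  qed
qed

lemma diagonal_exponents_exist:
  "\<exists>k. diagonal_exponents (z :: ('p::prime_card, 'n::{finite,linorder}) padic_matrix) k"
proof -
  obtain z' k where eq: "gl_equiv z z'" and pd: "partially_diagonal UNIV z' k"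
    using partial_diagonalization[of z UNIV] by blast
  have z': "\<And>i j. i \<noteq> j \<Longrightarrow> z' $ i $ j = 0"
    "\<And>i. z' $ i $ i = p_neg_power (k i)" "\<And>i. k i \<noteq> Pinf" "\<And>i j. i \<le> j \<Longrightarrow> k j \<le> k i"
    using pd by (simp_all add: partially_diagonal_def)
  have "z' = (\<chi> i j. if i = j then p_neg_power (k i) else 0)"
    using z'(1,2) by (simp add: vec_eq_iff)
  then show ?thesis
    using eq z'(3,4) by (auto simp: diagonal_exponents_def gl_equiv_def antimono_def)
qed

lemma diagonal_exponents_exponents: "diagonal_exponents z (exponents z)"
  unfolding exponents_def by (rule someI_ex[OF diagonal_exponents_exist])

section \<open>The integral\<close>

definition image_lattice :: "('p::prime_card, 'n::finite) padic_matrix \<Rightarrow> ('p padic, 'n) vec set" where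
  "image_lattice z = {x + z *v y | x y. x \<in> integral_vectors \<and> y \<in> integral_vectors}"

lemma generated_lattice_columns:
  "generated_lattice UNIV (\<lambda>j. column j z) = image_lattice z"
proof (intro equalityI subsetI)
  fix v assume "v \<in> generated_lattice UNIV (\<lambda>j. column j z)"
  then obtain x c where x: "x \<in> integral_vectors" "\<And>j. c j \<in> padic_integers"
    "v = x + (\<Sum>j\<in>UNIV. c j *s column j z)"
    by (auto simp: generated_lattice_def)
  then have "v = x + z *v (\<chi> j. c j)" by (simp add: matrix_mult_sum)
  moreover have "(\<chi> j. c j) \<in> integral_vectors" using x(2) by (simp add: integral_vectors_def)
  ultimately show "v \<in> image_lattice z" using x(1) by (auto simp: image_lattice_def)
next
  fix v assume "v \<in> image_lattice z"
  then obtain x y where "x \<in> integral_vectors" "y \<in> integral_vectors" "v = x + z *v y"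
    by (auto simp: image_lattice_def)
  then show "v \<in> generated_lattice UNIV (\<lambda>j. column j z)"
    unfolding generated_lattice_def integral_vectors_def matrix_mult_sum by blast
qed

lemma integral_matrix_vector:
  "A \<in> integral_matrices \<Longrightarrow> x \<in> integral_vectors \<Longrightarrow> A *v x \<in> integral_vectors"
  by (auto simp: integral_matrices_def integral_vectors_def matrix_vector_mult_def
      intro!: padic_integers_sum padic_integers_closed)

text \<open>For integral \<open>y\<close> the vector \<open>w *v y\<close> is absorbed by the
  integral summand; \<open>- w\<close> gives the other inclusion. Hence \<open>gamma\<close> is
  constant on cosets of integral matrices.\<close>

lemma image_lattice_add_integral:
  assumes w: "w \<in> integral_matrices"
  shows "image_lattice (z + w) = image_lattice z"
proof -
  have sub: "image_lattice (z + w) \<subseteq> image_lattice z" if w: "w \<in> integral_matrices" for z w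
  proof
    fix v assume "v \<in> image_lattice (z + w)"
    then obtain x y where x: "x \<in> integral_vectors" "y \<in> integral_vectors" "v = x + (z + w) *v y"
      by (auto simp: image_lattice_def)
    then have "v = (x + w *v y) + z *v y" by (simp add: matrix_vector_mult_add_rdistrib)
    then show "v \<in> image_lattice z"
      unfolding image_lattice_def using x integral_vectors_closed(2)[OF x(1) integral_matrix_vector[OF w x(2)]] by blast
  qed
  have "- w \<in> integral_matrices" using w by (simp add: integral_matrices_def padic_integers_closed)
  then show ?thesis using sub[OF w, of z] sub[of "- w" "z + w"] by simp
qed

text \<open>Coordinatewise, \<O> plus \<open>p^(-k) \<O>\<close> is
  \<open>p^(-max k 0) \<O>\<close>, so the lattice is a box. Negative exponents and
  \<open>Minf\<close> contribute the factor 1.\<close>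

lemma lat_index_image_lattice_diagonal:
  fixes k :: "'n::finite \<Rightarrow> int extended"
  assumes "\<And>i. k i \<noteq> Pinf"
  shows "lat_index (image_lattice (\<chi> i j. if i = j then p_neg_power (k i) else 0 :: ('p::prime_card, 'n) padic_matrix))
    = ennreal (\<Prod>i | k i > Fin 0. case k i of Fin k \<Rightarrow> real CARD('p) powi k)"
proof -
  define e where "e i = (case k i of Fin a \<Rightarrow> nat a | _ \<Rightarrow> 0)" for i
  let ?D = "\<chi> i j. if i = j then p_neg_power (k i) else 0 :: ('p, 'n) padic_matrix"
  have D: "(?D *v y) $ i = p_neg_power (k i) * y $ i" for y i
    by (simp add: matrix_vector_mult_def if_distrib[of "\<lambda>x. x * _"] cong: if_cong)
  have pe: "padic_p ^ e i * p_neg_power (k i) \<in> (padic_integers :: 'p padic set)" for i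
  proof (cases "k i")
    case (Fin a)
    have "padic_p ^ e i * p_neg_power (k i) = (padic_p powi int (e i) * padic_p powi (- a) :: 'p padic)"
      by (simp add: Fin)
    also have "\<dots> = padic_p powi (int (e i) + - a)" by (rule power_int_add[symmetric]) simp
    finally show ?thesis by (simp only: padic_p_powi_integral_iff) (simp add: e_def Fin)
  qed (use assms in \<open>simp_all add: padic_integers_closed\<close>)
  have "image_lattice ?D = {v. \<forall>i. padic_p ^ e i * v $ i \<in> padic_integers}"
  proof (intro equalityI subsetI)
    fix v assume "v \<in> image_lattice ?D"
    then obtain x y where x: "x \<in> integral_vectors" "y \<in> integral_vectors" "v = x + ?D *v y"
      by (auto simp: image_lattice_def)
    have "padic_p ^ e i * v $ i = padic_p ^ e i * x $ i + (padic_p ^ e i * p_neg_power (k i)) * y $ i" for i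
      by (simp add: x(3) D distrib_left mult.assoc)
    moreover have "padic_p ^ e i * x $ i + (padic_p ^ e i * p_neg_power (k i)) * y $ i \<in> padic_integers" for i
    proof -
      have "x $ i \<in> padic_integers" "y $ i \<in> padic_integers" using x(1,2) by (auto simp: integral_vectors_def)
      then show ?thesis
        by (intro padic_integers_closed(4) padic_integers_closed(7)[OF pe]
          padic_integers_closed(7)[OF padic_integers_power[OF padic_integers_closed(3)]])
    qed
    ultimately show "v \<in> {v. \<forall>i. padic_p ^ e i * v $ i \<in> padic_integers}" by simp
  next
    fix v :: "('p padic, 'n) vec" assume v: "v \<in> {v. \<forall>i. padic_p ^ e i * v $ i \<in> padic_integers}"
    \<comment> \<open>Coordinates with positive exponent are produced by the diagonal matrix; the
      others are already integral.\<close>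
    define x where "x = (\<chi> i. if k i > Fin 0 then 0 else v $ i)"
    define y where "y = (\<chi> i. if k i > Fin 0 then padic_p ^ e i * v $ i else 0)"
    have vi: "padic_p ^ e i * v $ i \<in> padic_integers" for i using v by simp
    have e0: "e i = 0" if "\<not> k i > Fin 0" for i
      using that by (cases "k i") (auto simp: e_def)
    have "x $ i \<in> padic_integers" for i
      using vi[of i] e0[of i] by (auto simp: x_def padic_integers_closed)
    moreover have "y $ i \<in> padic_integers" for i
      using vi[of i] by (simp add: y_def padic_integers_closed)
    ultimately have "x \<in> integral_vectors" "y \<in> integral_vectors"
      by (simp_all add: integral_vectors_def)
    moreover have "v = x + ?D *v y"
    proof -
      have "p_neg_power (k i) * (padic_p ^ e i * v $ i) = v $ i" if pos: "k i > Fin 0" for i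
      proof (cases "k i")
        case (Fin a)
        with pos have "a > 0" by simp
        then have "padic_p ^ e i = (padic_p powi a :: 'p padic)" by (simp add: e_def Fin power_int_def)
        then show ?thesis by (simp add: Fin power_int_minus)
      qed (use pos assms in auto)
      then show ?thesis by (simp add: vec_eq_iff D) (simp add: x_def y_def)
    qed
    ultimately show "v \<in> image_lattice ?D" by (auto simp: image_lattice_def)
  qed
  then have "lat_index (image_lattice ?D) = ennreal (\<Prod>i\<in>UNIV. real CARD('p) ^ e i)"
    by (simp add: lat_index_box)
  also have "(\<Prod>i\<in>UNIV. real CARD('p) ^ e i) = (\<Prod>i | k i > Fin 0. real CARD('p) ^ e i)"
  proof (rule prod.mono_neutral_right)
    show "\<forall>i\<in>UNIV - {i. Fin 0 < k i}. real CARD('p) ^ e i = 1"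
    proof
      fix i assume "i \<in> UNIV - {i. Fin 0 < k i}"
      then have "e i = 0" by (cases "k i") (auto simp: e_def)
      then show "real CARD('p) ^ e i = 1" by simp
    qed
  qed auto
  also have "\<dots> = (\<Prod>i | k i > Fin 0. case k i of Fin k \<Rightarrow> real CARD('p) powi k)"
  proof (rule prod.cong)
    fix i assume i: "i \<in> {i. k i > Fin 0}"
    show "real CARD('p) ^ e i = (case k i of Fin k \<Rightarrow> real CARD('p) powi k)"
      using i assms[of i] by (cases "k i") (auto simp: e_def power_int_def)
  qed simp
  finally show ?thesis .
qed

lemma lin_bij_matrix:
  fixes A :: "('p::prime_card, 'n::finite) padic_matrix"
  assumes "A ** B = mat 1" "B ** A = mat 1"
  shows "lin_bij ((*v) A)"
proof -
  have "bij ((*v) A)"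
    by (rule bij_betw_byWitness[where f' = "(*v) B"]) (auto simp: matrix_vector_mul_assoc assms)
  then show ?thesis
    by (simp add: lin_bij_def matrix_vector_right_distrib vector_scalar_commute)
qed

text \<open>Both \<open>A\<close> and \<open>B\<close> map \<O>^n onto itself. So \<open>B\<close>
  drops out, the lattice is the image under \<open>A\<close> of the one for the diagonal part, and
  by \<open>lat_index_image\<close> applying \<open>A\<close> does not change the index.\<close>

lemma lat_index_image_lattice:
  fixes z :: "('p::prime_card, 'n::{finite,linorder}) padic_matrix"
  shows "lat_index (image_lattice z) = ennreal (gamma z)"
proof -
  let ?k = "exponents z"
  let ?D = "\<chi> i j. if i = j then p_neg_power (?k i) else 0 :: ('p, 'n) padic_matrix"
  obtain A B where AB: "A \<in> integral_GL" "B \<in> integral_GL" "z = A ** ?D ** B" and k: "\<And>i. ?k i \<noteq> Pinf"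
    using diagonal_exponents_exponents[of z] by (auto simp: diagonal_exponents_def)
  obtain A' where A: "A \<in> integral_matrices" "A' \<in> integral_matrices" "A ** A' = mat 1" "A' ** A = mat 1"
    using AB(1) by (auto simp: integral_GL_def)
  obtain B' where B: "B \<in> integral_matrices" "B' \<in> integral_matrices" "B ** B' = mat 1" "B' ** B = mat 1"
    using AB(2) by (auto simp: integral_GL_def)
  have lin: "lin_bij ((*v) A)" by (rule lin_bij_matrix[OF A(3,4)])
  have A_image: "(*v) A ` integral_vectors = integral_vectors"
  proof (intro equalityI subsetI)
    fix x :: "('p padic, 'n) vec" assume "x \<in> integral_vectors"
    then have "A' *v x \<in> integral_vectors" "x = A *v (A' *v x)"
      by (simp_all add: integral_matrix_vector A matrix_vector_mul_assoc)
    then show "x \<in> (*v) A ` integral_vectors" by blast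
  qed (auto intro: integral_matrix_vector A)
  have "image_lattice z = (*v) A ` image_lattice ?D"
  proof (intro equalityI subsetI)
    fix v assume "v \<in> image_lattice z"
    then obtain x y where x: "x \<in> integral_vectors" "y \<in> integral_vectors" "v = x + z *v y"
      by (auto simp: image_lattice_def)
    have "v = A *v (A' *v x + ?D *v (B *v y))"
      by (simp add: x(3) AB(3) matrix_vector_right_distrib matrix_vector_mul_assoc A(3) matrix_mul_assoc)
    moreover have "A' *v x \<in> integral_vectors" "B *v y \<in> integral_vectors"
      using x A B by (simp_all add: integral_matrix_vector)
    ultimately show "v \<in> (*v) A ` image_lattice ?D" by (auto simp: image_lattice_def)
  next
    fix v assume "v \<in> (*v) A ` image_lattice ?D"
    then obtain x y where x: "x \<in> integral_vectors" "y \<in> integral_vectors" "v = A *v (x + ?D *v y)"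
      by (auto simp: image_lattice_def)
    have "z ** B' = A ** ?D" by (simp add: AB(3) matrix_mul_assoc[symmetric] B(3))
    then have "v = A *v x + z *v (B' *v y)"
      by (simp add: x(3) matrix_vector_right_distrib matrix_vector_mul_assoc)
    moreover have "A *v x \<in> integral_vectors" "B' *v y \<in> integral_vectors"
      using x A B by (simp_all add: integral_matrix_vector)
    ultimately show "v \<in> image_lattice z" by (auto simp: image_lattice_def)
  qed
  also have "lat_index \<dots> = lat_index ((*v) A ` integral_vectors) * lat_index (image_lattice ?D)"
  proof (rule lat_index_image[OF lin])
    fix x y :: "('p padic, 'n) vec" assume x: "x \<in> image_lattice ?D" and y: "y \<in> integral_vectors"
    obtain s t where st: "s \<in> integral_vectors" "t \<in> integral_vectors" "x = s + ?D *v t"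
      using x by (auto simp: image_lattice_def)
    then have "x + y = (s + y) + ?D *v t" by simp
    then show "x + y \<in> image_lattice ?D"
      unfolding image_lattice_def using st integral_vectors_closed(2)[OF st(1) y] by blast
  qed (simp add: A_image)
  also have "\<dots> = lat_index (image_lattice ?D)" by (simp add: A_image lat_index_integral_vectors)
  also have "\<dots> = ennreal (gamma z)" unfolding gamma_def by (rule lat_index_image_lattice_diagonal) (rule k)
  finally show ?thesis .
qed

lemma gamma_pos: "gamma z > 0"
proof -
  have "(case exponents z j of Fin k \<Rightarrow> real CARD('a) powi k) > 0" if "exponents z j > Fin 0" for j
    using that diagonal_exponents_exponents[of z]
    by (cases "exponents z j") (auto simp: diagonal_exponents_def)
  then show ?thesis unfolding gamma_def by (intro prod_pos) auto
qed

lemma gamma_eq_lat_index: "gamma z = enn2real (lat_index (generated_lattice UNIV (\<lambda>j. column j z)))"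
  using gamma_pos[of z] by (simp add: generated_lattice_columns lat_index_image_lattice)

section \<open>Cosets of integral matrices and the Haar measure\<close>

definition matrix_rep :: "('p::prime_card, 'n::finite) padic_matrix \<Rightarrow> ('p, 'n) padic_matrix" where
  "matrix_rep z = (\<chi> i j. frac_rep (z $ i $ j))"

definition matrix_reps :: "('p::prime_card, 'n::finite) padic_matrix set" where
  "matrix_reps = {z. matrix_rep z = z}"

lemma matrix_rep_in_reps [simp]: "matrix_rep z \<in> matrix_reps"
  by (simp add: matrix_rep_def matrix_reps_def vec_eq_iff)

lemma matrix_rep_eq_iff: "matrix_rep z = matrix_rep w \<longleftrightarrow> z - w \<in> integral_matrices"
  by (simp add: matrix_rep_def vec_eq_iff integral_matrices_def frac_rep_eq_iff)

lemma gamma_matrix_rep: "gamma (matrix_rep z) = gamma z"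
proof -
  have "matrix_rep z - z \<in> integral_matrices" by (subst matrix_rep_eq_iff[symmetric]) (metis (mono_tags) matrix_rep_in_reps matrix_reps_def mem_Collect_eq)
  then have "image_lattice (z + (matrix_rep z - z)) = image_lattice z" by (rule image_lattice_add_integral)
  then show ?thesis by (simp add: gamma_eq_lat_index generated_lattice_columns)
qed

lemma bij_betw_columns:
  "bij_betw (\<lambda>z j. column j z) (matrix_reps :: ('p::prime_card, 'n::finite) padic_matrix set) (PiE UNIV (\<lambda>_. vec_reps))"
  by (rule bij_betw_byWitness[where f' = "\<lambda>w. \<chi> i j. w j $ i"])
    (auto simp: matrix_reps_def matrix_rep_def vec_reps_def vec_rep_def column_def vec_eq_iff PiE_iff)

lemma countable_vec_reps: "countable (vec_reps :: ('p::prime_card padic, 'n::finite) vec set)"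
proof -
  have "vec_reps = {v :: ('p padic, 'n) vec. \<forall>i. v $ i \<in> {x. frac_rep x = x}}"
    by (auto simp: vec_reps_def vec_rep_def vec_eq_iff)
  moreover have "countable (PiE (UNIV :: 'n set) (\<lambda>_. {x :: 'p padic. frac_rep x = x}))"
    by (intro countable_PiE countable_frac_reps) simp
  ultimately show ?thesis
    using bij_betw_vec_nth[of "\<lambda>_ :: 'n. {x :: 'p padic. frac_rep x = x}"] unfolding bij_betw_def
    by (metis countable_image_inj_on)
qed

lemma countable_matrix_reps: "countable (matrix_reps :: ('p::prime_card, 'n::finite) padic_matrix set)"
proof -
  have "countable (PiE (UNIV :: 'n set) (\<lambda>_. vec_reps :: ('p padic, 'n) vec set))"
    by (intro countable_PiE countable_vec_reps) simp
  then show ?thesis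
    using bij_betw_columns[where 'p='p and 'n='n] unfolding bij_betw_def by (metis countable_image_inj_on)
qed

text \<open>\<O> is the closed unit ball, by \<open>padic_abs_le_iff\<close> at exponent 0, so the
  open ball of radius 1 about a point of a coset stays in that coset.\<close>

lemma open_padic_integers_coset: "open {x :: 'p::prime_card padic. x - c \<in> padic_integers}"
  unfolding open_dist
proof (intro ballI exI[of _ 1] conjI allI impI)
  fix x y :: "'p padic"
  assume x: "x \<in> {x. x - c \<in> padic_integers}" and "dist y x < 1"
  then have "padic_abs (y - x) \<le> real CARD('p) powi (- 0)" by (simp add: dist_padic_def)
  then have "y - x \<in> padic_integers" by (simp only: padic_abs_le_iff) simp
  then have "(y - x) + (x - c) \<in> padic_integers" using x by (intro padic_integers_closed(4)) auto
  then show "y \<in> {x. x - c \<in> padic_integers}" by simp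
qed simp

lemma open_integral_matrices_coset:
  "open {z :: ('p::prime_card, 'n::finite) padic_matrix. z - c \<in> integral_matrices}"
proof -
  have eq: "{z. z - c \<in> integral_matrices} =
    (\<Inter>i. \<Inter>j. (\<lambda>z. z $ i) -` ((\<lambda>v. v $ j) -` {x. x - c $ i $ j \<in> padic_integers}))"
    by (auto simp: integral_matrices_def)
  show ?thesis
    unfolding eq by (intro open_INT finite ballI open_vimage_vec_nth open_padic_integers_coset)
qed

text \<open>The fibres of \<open>matrix_rep\<close> over its values are the countably many cosets of
  integral matrices, each open and, by translation invariance, of volume 1. Integrals of functions
  constant on cosets thereby become sums.\<close>

lemma distr_matrix_rep:
  fixes vol :: "('p::prime_card, 'n::finite) padic_matrix measure"
  assumes vol: "normalized_haar vol"
  shows "matrix_rep \<in> measurable vol (count_space matrix_reps)"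
    and "distr vol (count_space matrix_reps) matrix_rep = count_space matrix_reps"
proof -
  have sets: "sets vol = sets borel" using vol by (simp add: normalized_haar_def)
  then have space: "space vol = UNIV" using sets_eq_imp_space_eq by fastforce
  have pre: "matrix_rep -` {c} = {z. z - c \<in> integral_matrices}" if "c \<in> matrix_reps" for c :: "('p, 'n) padic_matrix"
    using that matrix_rep_eq_iff[of _ c] by (auto simp: matrix_reps_def)
  have coset: "{z. z - c \<in> integral_matrices} = (+) c ` integral_matrices" for c :: "('p, 'n) padic_matrix"
    by (auto simp: image_iff) (metis add.commute diff_add_cancel)
  have meas: "{z. z - c \<in> integral_matrices} \<in> sets vol" for c
    unfolding sets by (intro borel_open open_integral_matrices_coset)
  show m: "matrix_rep \<in> measurable vol (count_space matrix_reps)"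
    unfolding measurable_count_space_eq_countable[OF countable_matrix_reps]
    by (auto simp: space pre meas)
  show "distr vol (count_space matrix_reps) matrix_rep = count_space matrix_reps"
  proof (rule measure_eqI_countable[where A = matrix_reps])
    fix c :: "('p, 'n) padic_matrix" assume c: "c \<in> matrix_reps"
    have "emeasure (distr vol (count_space matrix_reps) matrix_rep) {c} = emeasure vol (matrix_rep -` {c})"
      using c by (simp add: emeasure_distr[OF m] space)
    also have "\<dots> = emeasure vol ((+) c ` integral_matrices)" by (simp add: pre[OF c] coset)
    also have "\<dots> = emeasure vol integral_matrices"
      using vol meas[of 0] by (simp add: normalized_haar_def)
    also have "\<dots> = 1" using vol by (simp add: normalized_haar_def)
    finally show "emeasure (distr vol (count_space matrix_reps) matrix_rep) {c} = emeasure (count_space matrix_reps) {c}"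
      using c by simp
  qed (simp_all add: countable_matrix_reps)
qed

theorem theorem1p1:
  fixes vol :: "('p::prime_card, 'n::{finite,linorder}) padic_matrix measure"
    and p n :: nat and \<alpha> :: real
  assumes "p = CARD('p)" and "n = CARD('n)"
    and "normalized_haar vol"
    and "\<alpha> > 2 * real n - 1"
  shows "integrable vol (\<lambda>z. gamma z powr (- \<alpha>)) \<and>
    (\<integral>z. gamma z powr (- \<alpha>) \<partial>vol) =
      (\<Prod>j = 1..n. (1 - real p powr (- \<alpha> + real n - real j)) /
                    (1 - real p powr (- \<alpha> + real n + real j - 1)))"
proof -
  let ?f = "\<lambda>z :: ('p, 'n) padic_matrix. ennreal (gamma z powr (- \<alpha>))"
  let ?F = "\<lambda>i. column_factor (real p) (real n) (\<alpha> - real i)"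
  note meas = distr_matrix_rep(1)[OF assms(3)] and distr = distr_matrix_rep(2)[OF assms(3)]
  have q: "real p > 1" using card_prime_gt_1[where 'p='p] assms(1) by simp
  have F_nonneg: "?F i \<ge> 0" if "i < n" for i
  proof -
    \<comment> \<open>With \<open>i \<le> n - 1\<close>, the hypothesis on \<alpha> gives
      \<open>n + i - \<alpha> < 0\<close>, so both powers of \<open>p\<close> stay below 1.\<close>
    have "real i + 1 \<le> real n" using that by simp
    then have "real p powr (- (\<alpha> - real i)) < 1" "real p powr (real n - (\<alpha> - real i)) < 1"
      using q assms(4) by (auto intro!: powr_less_one)
    then show ?thesis by (simp add: column_factor_def)
  qed
  \<comment> \<open>Measurability is free here: the function factors through
    \<open>matrix_rep\<close> into a discrete space.\<close>
  have "(\<lambda>z. gamma (matrix_rep z) powr (- \<alpha>)) \<in> borel_measurable vol"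
    by (rule measurable_compose[OF meas, where g = "\<lambda>z. gamma z powr (- \<alpha>)"]) simp
  then have f_meas: "(\<lambda>z. gamma z powr (- \<alpha>)) \<in> borel_measurable vol" by (simp add: gamma_matrix_rep)
  have "(\<integral>\<^sup>+z. ?f z \<partial>vol) = (\<integral>\<^sup>+z. ?f (matrix_rep z) \<partial>vol)"
    by (simp add: gamma_matrix_rep)
  also have "\<dots> = (\<integral>\<^sup>+z. ?f z \<partial>distr vol (count_space matrix_reps) matrix_rep)"
    by (rule nn_integral_distr[OF meas, symmetric]) simp
  also have "\<dots> = (\<integral>\<^sup>+(z :: ('p, 'n) padic_matrix). ennreal (enn2real (lat_index (generated_lattice UNIV (\<lambda>j. column j z))) powr (- \<alpha>)) \<partial>count_space matrix_reps)"
    by (simp add: distr gamma_eq_lat_index)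
  also have "\<dots> = (\<integral>\<^sup>+w. ennreal (enn2real (lat_index (generated_lattice UNIV w)) powr (- \<alpha>))
      \<partial>count_space (PiE (UNIV :: 'n set) (\<lambda>_. vec_reps :: ('p padic, 'n) vec set)))"
    by (rule nn_integral_bij_count_space[OF bij_betw_columns])
  also have "\<dots> = (\<Prod>i<n. ennreal (?F i))"
    unfolding assms(1,2) using assms(2,4) by (intro nn_integral_generated_lattice) auto
  also have "\<dots> = ennreal (\<Prod>i<n. ?F i)"
    using F_nonneg by (intro prod_ennreal) auto
  finally have nn: "(\<integral>\<^sup>+z. ?f z \<partial>vol) = ennreal (\<Prod>i<n. ?F i)" .
  have "has_bochner_integral vol (\<lambda>z. gamma z powr (- \<alpha>)) (\<Prod>i<n. ?F i)"
    by (rule has_bochner_integral_nn_integral[OF f_meas _ _ nn]) (use F_nonneg in \<open>auto intro!: prod_nonneg\<close>)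
  moreover have "(\<Prod>i<n. ?F i) = (\<Prod>j = 1..n. (1 - real p powr (- \<alpha> + real n - real j)) /
                    (1 - real p powr (- \<alpha> + real n + real j - 1)))"
  proof -
    \<comment> \<open>The factors do not match one by one: numerators correspond under
      \<open>i = n - j\<close>, denominators under \<open>i = j - 1\<close>. The two products are
      therefore reindexed separately.\<close>
    have "(\<Prod>i<n. 1 - real p powr (- (\<alpha> - real i))) = (\<Prod>j = 1..n. 1 - real p powr (- \<alpha> + real n - real j))"
      by (rule prod.reindex_bij_witness[where i = "\<lambda>j. n - j" and j = "\<lambda>i. n - i"])
        (auto simp: of_nat_diff)
    moreover have "(\<Prod>i<n. 1 - real p powr (real n - (\<alpha> - real i))) = (\<Prod>j = 1..n. 1 - real p powr (- \<alpha> + real n + real j - 1))"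
      by (rule prod.reindex_bij_witness[where i = "\<lambda>j. j - 1" and j = Suc])
        (auto simp: algebra_simps)
    ultimately show ?thesis by (simp add: column_factor_def prod_dividef)
  qed
  ultimately show ?thesis by (simp add: has_bochner_integral_iff)
qed

end
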